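(* For every $\varepsilon>0$, as $H\to\infty$, \[ \sum_{1\le x,y,z\le H}\mu^2(x^2+y^2+z+1)\,\mu^2(x^2+y^2+z+2) =\prod_{p}\left(1-\frac{\lambda^\ast(p^2,1)+\lambda^\ast(1,p^2)}{p^6}\right)H^3+\mathcal{O}\!\left(H^{\frac52+\varepsilon}\right), \] where the sum is over integers $x,y,z$, the product runs over all primes $p$, and the implied constant depends only on $\varepsilon$.
   Context: $\mu$ is the Möbius function. For positive integers $q_1,q_2$, $\lambda^\ast(q_1,q_2)$ denotes the number of triples of integers $(x,y,z)$ with $1\le x,y,z\le q_1q_2$ such that $x^2+y^2+z+1\equiv 0 \pmod{q_1}$ and $x^2+y^2+z+2\equiv 0\pmod{q_2}$. *)

theory Defs
  imports
    "HOL-Analysis.Analysis"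
    "HOL-Number_Theory.Cong"
    "HOL-Computational_Algebra.Squarefree"
    "HOL-Library.Landau_Symbols"
begin

definition moebius_mu :: "nat \<Rightarrow> int" where
  "moebius_mu n = (if squarefree n then (- 1) ^ card (prime_factors n) else 0)"

definition lambda_star :: "nat \<Rightarrow> nat \<Rightarrow> nat" where
  "lambda_star q1 q2 = card {(x, y, z).
     x \<in> {1..q1 * q2} \<and> y \<in> {1..q1 * q2} \<and> z \<in> {1..q1 * q2} \<and>
     [x^2 + y^2 + z + 1 = 0] (mod q1) \<and> [x^2 + y^2 + z + 2 = 0] (mod q2)}"

(* The cutoff H is real; a positive integer is at most H iff, as a natural number,
   it is at most nat (floor H). *)
definition consecutive_squarefree_sum :: "real \<Rightarrow> int" where
  "consecutive_squarefree_sum H =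
     (\<Sum>x\<in>{1..nat \<lfloor>H\<rfloor>}. \<Sum>y\<in>{1..nat \<lfloor>H\<rfloor>}. \<Sum>z\<in>{1..nat \<lfloor>H\<rfloor>}.
        (moebius_mu (x^2 + y^2 + z + 1))^2 * (moebius_mu (x^2 + y^2 + z + 2))^2)"

(* The Euler product is written as a product over all natural numbers by giving
   every non-prime index the factor 1. *)
definition euler_factor :: "nat \<Rightarrow> real" where
  "euler_factor p = (if prime p
     then 1 - (real (lambda_star (p^2) 1) + real (lambda_star 1 (p^2))) / real p ^ 6
     else 1)"

end

(* With n = x^2 + y^2 + z + 1, the summand is the indicator of n (n + 1) being squarefree, that is,
   the sum of mu(m) over the squarefree m with m^2 dvd n (n + 1). Let H = h be an integer.

   For m^2 <= h and fixed x, y, the variable z runs through an interval, in which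
   m^2 dvd n (n + 1) holds for tau(m) residue classes modulo m^2 (choose d = gcd(m, n); then
   n = 0 mod d^2 and n = -1 mod (m/d)^2). This gives the main term, since the local densities are
   lambda*(p^2,1) = lambda*(1,p^2) = p^4 and hence the Euler product is the sum of
   mu(m) tau(m) / m^2; the error is O(h^(1/2 + delta)) for each of the h^2 pairs (x, y).

   The m with m^2 > h contribute only if n lies in a set of O(h^(3/2 + delta)) bad integers,
   and then at most 2^omega(n (n + 1)) = O(h^(4 delta)). Each n is attained by O(h^(1 + delta))
   triples: for x <= y and fixed x, the squares y^2 lie in an interval of length h, while the gaps
   between them are at least x, so there are at most 1 + h/x choices of y. *)
theory Submission
  imports Defs
begin

section \<open>Squarefree numbers as finite sets of primes, and Moebius inversion over square
  divisors\<close>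

lemma moebius_mu_square:
  "(moebius_mu n)\<^sup>2 = of_bool (squarefree n)"
  by (simp add: moebius_mu_def power2_eq_square flip: power_mult_distrib)

lemma abs_moebius_mu_le: "\<bar>moebius_mu n\<bar> \<le> 1"
  by (simp add: moebius_mu_def power_abs)

lemma squarefree_eq_prod_prime_factors:
  fixes m :: nat
  assumes "squarefree m"
  shows "\<Prod>(prime_factors m) = m"
proof -
  have m0: "m \<noteq> 0" using assms by (metis not_squarefree_0)
  have "multiplicity p m = 1" if "p \<in> prime_factors m" for p
    using assms m0 that squarefree_factorial_semiring' by blast
  then have "(\<Prod>p\<in>prime_factors m. p ^ multiplicity p m) = \<Prod>(prime_factors m)"
    by (intro prod.cong) auto
  then show ?thesis using m0 prime_factorization_nat[of m] by simp
qed

lemma squarefree_prod_primes: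
  fixes X :: "nat set"
  assumes "finite X" "X \<subseteq> Collect prime"
  shows "squarefree (\<Prod>X)" "prime_factors (\<Prod>X) = X"
proof -
  show "squarefree (\<Prod>X)"
  proof (rule squarefree_prod_coprime)
    show "coprime p q" if "p \<in> X" "q \<in> X" "p \<noteq> q" for p q
      using that assms(2) by (intro primes_coprime) auto
    show "squarefree p" if "p \<in> X" for p
      using that assms(2) by (intro squarefree_prime) auto
  qed
  have "0 \<notin> X" using assms(2) not_prime_0 by blast
  then have "prime_factors (\<Prod>X) = (\<Union>p\<in>X. prime_factors p)"
    using prime_factors_prod[of X "\<lambda>p. p"] assms(1) by simp
  also have "\<dots> = (\<Union>p\<in>X. {p})" by (intro SUP_cong refl prime_prime_factors) (use assms(2) in auto)
  finally show "prime_factors (\<Prod>X) = X" by simp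
qed

text \<open>A squarefree number is the product of its prime factors, so taking prime factors and
  taking products invert each other. Sums over squarefree m thereby become sums over subsets of
  Q.\<close>

lemma bij_betw_prime_factors_squarefree:
  fixes Q :: "nat set"
  assumes "finite Q" "Q \<subseteq> Collect prime"
  shows "bij_betw prime_factors {m. squarefree m \<and> prime_factors m \<subseteq> Q} (Pow Q)"
proof (rule bij_betw_byWitness[where f' = "\<lambda>X. \<Prod>X"])
  have *: "squarefree (\<Prod>X) \<and> prime_factors (\<Prod>X) = X" if "X \<subseteq> Q" for X
    by (intro conjI squarefree_prod_primes finite_subset[OF that assms(1)]
        order_trans[OF that assms(2)])
  show "\<forall>a\<in>{m. squarefree m \<and> prime_factors m \<subseteq> Q}. \<Prod>(prime_factors a) = a"
    by (simp add: squarefree_eq_prod_prime_factors)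
  show "\<forall>a'\<in>Pow Q. prime_factors (\<Prod>a') = a'" using * by blast
  show "(\<lambda>X. \<Prod>X) ` Pow Q \<subseteq> {m. squarefree m \<and> prime_factors m \<subseteq> Q}" using * by blast
qed blast

lemma finite_squarefree_primes_in:
  fixes Q :: "nat set"
  assumes "finite Q" "Q \<subseteq> Collect prime"
  shows "finite {m. squarefree m \<and> prime_factors m \<subseteq> Q}"
    "card {m. squarefree m \<and> prime_factors m \<subseteq> Q} = 2 ^ card Q"
proof -
  note bij = bij_betw_prime_factors_squarefree[OF assms]
  show "finite {m. squarefree m \<and> prime_factors m \<subseteq> Q}"
    by (simp only: bij_betw_finite[OF bij] finite_Pow_iff assms(1))
  show "card {m. squarefree m \<and> prime_factors m \<subseteq> Q} = 2 ^ card Q"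
    by (simp only: bij_betw_same_card[OF bij] card_Pow[OF assms(1)])
qed

text \<open>Multiplying out the right-hand side yields one term for each subset of Q, hence one for
  each squarefree m. It is used with g = -1 for Moebius inversion and with g p = -2 / p^2 for the
  Euler product.\<close>

lemma sum_squarefree_eq_prod:
  fixes Q :: "nat set" and g :: "nat \<Rightarrow> 'a :: comm_ring_1"
  assumes "finite Q" "Q \<subseteq> Collect prime"
  shows "(\<Sum>m | squarefree m \<and> prime_factors m \<subseteq> Q. \<Prod>p\<in>prime_factors m. g p) = (\<Prod>p\<in>Q. 1 + g p)"
proof -
  have "(\<Prod>p\<in>Q. 1 + g p) = (\<Prod>p\<in>Q. g p + 1)" by (simp add: add.commute)
  also have "\<dots> = (\<Sum>X\<in>Pow Q. \<Prod>p\<in>X. g p)" by (simp add: prod_add[OF assms(1)])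
  also have "\<dots> = (\<Sum>m | squarefree m \<and> prime_factors m \<subseteq> Q. \<Prod>p\<in>prime_factors m. g p)"
    by (rule sum.reindex_bij_betw[symmetric, OF bij_betw_prime_factors_squarefree[OF assms]])
  finally show ?thesis by simp
qed

text \<open>Squares of distinct primes are coprime, so their product divides N as soon as each of
  them does.\<close>

lemma squarefree_square_dvd_iff:
  fixes m N :: nat
  assumes "squarefree m"
  shows "m\<^sup>2 dvd N \<longleftrightarrow> (\<forall>p\<in>prime_factors m. p\<^sup>2 dvd N)"
proof
  assume "m\<^sup>2 dvd N"
  then show "\<forall>p\<in>prime_factors m. p\<^sup>2 dvd N"
    by (blast intro: dvd_trans dvd_power_same dest: in_prime_factors_imp_dvd)
next
  assume *: "\<forall>p\<in>prime_factors m. p\<^sup>2 dvd N"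
  have "[N = 0] (mod (\<Prod>p\<in>prime_factors m. p\<^sup>2))"
    using * by (intro cong_cong_prod_coprime_nat) (auto simp: cong_0_iff in_prime_factors_iff primes_coprime)
  then have "(\<Prod>p\<in>prime_factors m. p\<^sup>2) dvd N" by (simp add: cong_0_iff)
  then show "m\<^sup>2 dvd N"
    by (simp only: prod_power_distrib[symmetric] squarefree_eq_prod_prime_factors[OF assms])
qed

definition square_divisors :: "nat \<Rightarrow> nat set" where
  "square_divisors N = {m. squarefree m \<and> m\<^sup>2 dvd N}"

lemma square_divisors_eq:
  "square_divisors N = {m. squarefree m \<and> prime_factors m \<subseteq> {p. prime p \<and> p\<^sup>2 dvd N}}"
  by (auto simp: square_divisors_def squarefree_square_dvd_iff in_prime_factors_iff)

text \<open>By \<open>square_divisors_eq\<close> the elements correspond to subsets of the set of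
  primes p with p^2 dvd N. The sum of mu is therefore the product of 1 - 1 over that set, which
  vanishes unless the set is empty.\<close>

lemma square_divisors_moebius_inversion:
  assumes "N > 0"
  shows "finite (square_divisors N)" "card (square_divisors N) \<le> 2 ^ card (prime_factors N)"
    "(\<Sum>m\<in>square_divisors N. moebius_mu m) = of_bool (squarefree N)"
proof -
  let ?Q = "{p. prime p \<and> p\<^sup>2 dvd N}"
  have Q: "?Q \<subseteq> prime_factors N"
    using assms by (auto simp: in_prime_factors_iff power2_eq_square dest: dvd_mult_left)
  then have fin: "finite ?Q" by (rule finite_subset) simp
  have prime: "?Q \<subseteq> Collect prime" by blast
  show "finite (square_divisors N)"
    unfolding square_divisors_eq by (rule finite_squarefree_primes_in[OF fin prime])
  have "card (square_divisors N) = 2 ^ card ?Q"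
    unfolding square_divisors_eq by (rule finite_squarefree_primes_in[OF fin prime])
  also have "\<dots> \<le> 2 ^ card (prime_factors N)" by (intro power_increasing card_mono Q) auto
  finally show "card (square_divisors N) \<le> 2 ^ card (prime_factors N)" .
  have "(\<Sum>m\<in>square_divisors N. moebius_mu m)
      = (\<Sum>m\<in>square_divisors N. \<Prod>p\<in>prime_factors m. -1)"
    by (intro sum.cong) (auto simp: square_divisors_def moebius_mu_def)
  also have "\<dots> = (\<Prod>p\<in>?Q. 1 + (-1))"
    unfolding square_divisors_eq by (rule sum_squarefree_eq_prod[OF fin prime])
  also have "\<dots> = of_bool (?Q = {})"
  proof (cases "?Q = {}")
    case False
    then have "card ?Q \<noteq> 0" using fin card_0_eq by blast
    then show ?thesis using False by (simp only: prod_constant) simp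
  qed (simp only: prod.empty, simp)
  also have "?Q = {} \<longleftrightarrow> squarefree N"
    using assms squarefree_factorial_semiring[of N] by auto
  finally show "(\<Sum>m\<in>square_divisors N. moebius_mu m) = of_bool (squarefree N)" .
qed

section \<open>The bound for 2^omega(n)\<close>

text \<open>Primes above \<open>P\<close> satisfy 2 <= p^\<delta>, and the product of those dividing
  n is at most n. The remaining primes are at most \<open>P\<close> and contribute only a constant
  factor.\<close>

lemma two_power_omega_le:
  fixes \<delta> :: real
  assumes "\<delta> > 0"
  obtains K where "K > 0" "\<And>n::nat. n > 0 \<Longrightarrow> 2 ^ card (prime_factors n) \<le> K * real n powr \<delta>"
proof -
  define P where "P = nat \<lceil>2 powr (1/\<delta>)\<rceil>"
  have P: "2 \<le> real p powr \<delta>" if "p > P" for p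
  proof -
    have "2 powr (1/\<delta>) \<le> real p" using that unfolding P_def by linarith
    then have "(2 powr (1/\<delta>)) powr \<delta> \<le> real p powr \<delta>" using assms by (intro powr_mono2) auto
    then show ?thesis using assms by (simp add: powr_powr)
  qed
  have "2 ^ card (prime_factors n) \<le> 2 ^ (P+1) * real n powr \<delta>" if n: "n > 0" for n :: nat
  proof -
    let ?A = "{p\<in>prime_factors n. p \<le> P}" and ?B = "{p\<in>prime_factors n. p > P}"
    have "prime_factors n = ?A \<union> ?B" by auto
    then have "card (prime_factors n) = card ?A + card ?B"
      by (metis (no_types, lifting) card_Un_disjoint disjoint_iff finite_Un finite_set_mset
          mem_Collect_eq not_le)
    then have "(2::real) ^ card (prime_factors n) = 2 ^ card ?A * 2 ^ card ?B" by (simp add: power_add)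
    also have "(2::real) ^ card ?A \<le> 2 ^ (P+1)"
      using card_mono[of "{..P}" ?A] by (intro power_increasing) auto
    also have "(2::real) ^ card ?B = (\<Prod>p\<in>?B. 2)" by simp
    also have "(\<Prod>p\<in>?B. 2) \<le> (\<Prod>p\<in>?B. real p powr \<delta>)" by (intro prod_mono) (use P in auto)
    also have "\<dots> = real (\<Prod>?B) powr \<delta>" by (simp add: prod_powr_distrib)
    also have "\<dots> \<le> real n powr \<delta>"
    proof -
      have "\<Prod>?B dvd (\<Prod>p\<in>?B. p ^ multiplicity p n)"
        using n by (intro prod_dvd_prod) (auto simp: in_prime_factors_iff prime_multiplicity_gt_zero_iff
          intro!: dvd_power)
      also have "\<dots> dvd (\<Prod>p\<in>prime_factors n. p ^ multiplicity p n)"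
        by (intro prod_dvd_prod_subset) auto
      also have "\<dots> = n" using n by (simp add: prime_factorization_nat[symmetric])
      finally have "\<Prod>?B \<le> n" using n by (rule dvd_imp_le)
      then show ?thesis using assms by (intro powr_mono2) (auto simp flip: of_nat_prod)
    qed
    finally show ?thesis by (simp add: mult_mono)
  qed
  then show ?thesis by (intro that[of "2 ^ (P+1)"]) auto
qed

section \<open>Counting the n in an interval with m^2 dvd n (n + 1)\<close>

text \<open>The class consists of the numbers k M + s with s = r mod M, and k runs through the
  integers in (u, v]. Before taking floors, v - u is exactly (b - a) / M.\<close>

lemma card_residue_class:
  fixes a b M r :: nat
  assumes "M > 0" "a \<le> b"
  shows "\<bar>real (card {n\<in>{a<..b}. n mod M = r mod M}) - (real b - real a) / real M\<bar> \<le> 1"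
proof -
  define s where "s = r mod M"
  have s: "s < M" using assms by (simp add: s_def)
  \<comment> \<open>If a < s then u is negative, so k has to be an integer. For k > u the value k M
    + s exceeds a >= 0, hence \<open>nat\<close> in \<open>f\<close> loses nothing.\<close>
  define u v where "u = \<lfloor>(real a - real s) / real M\<rfloor>" and "v = \<lfloor>(real b - real s) / real M\<rfloor>"
  define f where "f k = nat (k * int M + int s)" for k
  have uv: "u \<le> v" unfolding u_def v_def using assms by (intro floor_mono divide_right_mono) auto
  have iff: "u < k \<and> k \<le> v \<longleftrightarrow> int a < k * int M + int s \<and> k * int M + int s \<le> int b" for k
  proof -
    have "u < k \<longleftrightarrow> real a < of_int k * real M + real s"
      unfolding u_def floor_less_iff using assms by (simp add: field_simps)
    also have "\<dots> \<longleftrightarrow> real_of_int (int a) < real_of_int (k * int M + int s)" by simp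
    also have "\<dots> \<longleftrightarrow> int a < k * int M + int s" by (simp only: of_int_less_iff)
    finally have 1: "u < k \<longleftrightarrow> int a < k * int M + int s" .
    have "k \<le> v \<longleftrightarrow> of_int k * real M + real s \<le> real b"
      unfolding v_def le_floor_iff using assms by (simp add: field_simps)
    also have "\<dots> \<longleftrightarrow> real_of_int (k * int M + int s) \<le> real_of_int (int b)" by simp
    also have "\<dots> \<longleftrightarrow> k * int M + int s \<le> int b" by (simp only: of_int_le_iff)
    finally show ?thesis using 1 by blast
  qed
  have "bij_betw f {u<..v} {n\<in>{a<..b}. n mod M = s}"
  proof (rule bij_betw_byWitness[where f' = "\<lambda>n. int (n div M)"])
    have pos: "int (f k) = k * int M + int s" if "k \<in> {u<..v}" for k
      using iff[of k] that by (simp add: f_def)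
    show "\<forall>k\<in>{u<..v}. int (f k div M) = k"
      using pos s by (auto simp: zdiv_int)
    have m: "n div M * M + s = n" if "n mod M = s" for n
      using that div_mult_mod_eq by blast
    then have m': "int (n div M) * int M + int s = int n" if "n mod M = s" for n
      using that by (metis of_nat_add of_nat_mult)
    show "\<forall>n\<in>{n\<in>{a<..b}. n mod M = s}. f (int (n div M)) = n"
      using m' by (simp add: f_def)
    show "f ` {u<..v} \<subseteq> {n\<in>{a<..b}. n mod M = s}"
    proof (rule image_subsetI)
      fix k assume k: "k \<in> {u<..v}"
      have "int (f k mod M) = int s" using pos[OF k] s by (simp add: zmod_int)
      then show "f k \<in> {n\<in>{a<..b}. n mod M = s}" using pos[OF k] iff[of k] k by simp
    qed
    show "(\<lambda>n. int (n div M)) ` {n\<in>{a<..b}. n mod M = s} \<subseteq> {u<..v}"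
    proof (rule image_subsetI)
      fix n assume n: "n \<in> {n\<in>{a<..b}. n mod M = s}"
      show "int (n div M) \<in> {u<..v}" using iff[of "int (n div M)"] m'[of n] n by simp
    qed
  qed
  then have "card {n\<in>{a<..b}. n mod M = s} = card {u<..v}" by (rule bij_betw_same_card[symmetric])
  then have "real (card {n\<in>{a<..b}. n mod M = s}) = of_int v - of_int u"
    using uv by simp
  moreover have "(real b - real a) / real M = (real b - real s) / real M - (real a - real s) / real M"
    by (simp add: diff_divide_distrib)
  ultimately show ?thesis unfolding s_def[symmetric] u_def v_def by linarith
qed

lemma squarefree_mult_imp_coprime:
  fixes a b :: nat
  assumes "squarefree (a * b)"
  shows "coprime a b"
proof (rule coprimeI)
  fix c assume "c dvd a" "c dvd b"
  then have "c\<^sup>2 dvd a * b" by (simp add: power2_eq_square mult_dvd_mono)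
  then show "is_unit c" using assms squarefreeD by blast
qed

text \<open>As n and n + 1 are coprime, m is the product of d = gcd(m, n) and e = gcd(m, n + 1). The
  squares d^2 and e^2 divide n (n + 1), and each is coprime to one of the two factors, so it divides
  the other.\<close>

lemma square_dvd_consecutive_iff:
  fixes m n :: nat
  assumes "m > 0"
  shows "m\<^sup>2 dvd n * (n + 1) \<longleftrightarrow> (\<exists>d. d dvd m \<and> d\<^sup>2 dvd n \<and> (m div d)\<^sup>2 dvd n + 1)"
proof
  assume "\<exists>d. d dvd m \<and> d\<^sup>2 dvd n \<and> (m div d)\<^sup>2 dvd n + 1"
  then obtain d where d: "d dvd m" "d\<^sup>2 dvd n" "(m div d)\<^sup>2 dvd n + 1" by blast
  have "m = d * (m div d)" using d by simp
  then have "m\<^sup>2 = d\<^sup>2 * (m div d)\<^sup>2" by (metis power_mult_distrib)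
  then show "m\<^sup>2 dvd n * (n + 1)" using mult_dvd_mono[OF d(2,3)] by simp
next
  assume m: "m\<^sup>2 dvd n * (n + 1)"
  define d e where "d = gcd m n" and "e = gcd m (n + 1)"
  have co: "coprime n (n + 1)" by simp
  have "m dvd n * (n + 1)" using m by (metis dvd_mult_left power2_eq_square)
  then obtain b c where bc: "m = b * c" "b dvd n" "c dvd n + 1"
    using division_decomp by blast
  \<comment> \<open>The factors d and e are coprime, so their product divides m. Conversely, m = b c
    with b dividing d and c dividing e.\<close>
  have de: "d * e = m"
  proof (rule dvd_antisym)
    have "coprime d e" by (rule coprime_divisors[OF _ _ co]) (auto simp: d_def e_def)
    then show "d * e dvd m" by (intro divides_mult) (auto simp: d_def e_def)
    have "b dvd d" "c dvd e" using bc by (auto simp: d_def e_def)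
    then show "m dvd d * e" unfolding bc(1) by (rule mult_dvd_mono)
  qed
  have "d\<^sup>2 dvd m\<^sup>2" "e\<^sup>2 dvd m\<^sup>2" by (auto simp: d_def e_def)
  then have "d\<^sup>2 dvd n * (n + 1)" "e\<^sup>2 dvd n * (n + 1)" using m by (blast intro: dvd_trans)+
  moreover have "coprime (d\<^sup>2) (n + 1)" "coprime (e\<^sup>2) n"
  proof -
    have "coprime d (n + 1)" by (rule coprime_divisors[OF _ _ co]) (auto simp: d_def)
    then show "coprime (d\<^sup>2) (n + 1)" by simp
    have "coprime n e" by (rule coprime_divisors[OF _ _ co]) (auto simp: e_def)
    then show "coprime (e\<^sup>2) n" by (simp add: coprime_commute)
  qed
  ultimately have "d\<^sup>2 dvd n" "e\<^sup>2 dvd n + 1"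
    using coprime_dvd_mult_left_iff coprime_dvd_mult_right_iff by blast+
  moreover have "d dvd m" by (simp add: d_def)
  moreover have "(m div d)\<^sup>2 dvd n + 1"
    using de assms \<open>e\<^sup>2 dvd n + 1\<close> by auto
  ultimately show "\<exists>d. d dvd m \<and> d\<^sup>2 dvd n \<and> (m div d)\<^sup>2 dvd n + 1" by blast
qed

text \<open>The cofactor m / d divides n + 1 and is thus coprime to n, so it drops out of the gcd.
  Hence d is determined by m and n, and the sets belonging to different d are disjoint.\<close>

lemma gcd_eq_of_square_dvd_consecutive:
  fixes m n d :: nat
  assumes "d dvd m" "d\<^sup>2 dvd n" "(m div d)\<^sup>2 dvd n + 1"
  shows "gcd m n = d"
proof -
  have co: "coprime n (n + 1)" by simp
  have dn: "d dvd n" using assms(2) by (metis dvd_mult_left power2_eq_square)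
  have "m div d dvd n + 1" using assms(3) by (metis dvd_mult_left power2_eq_square)
  then have "coprime n (m div d)" by (rule coprime_divisors[OF dvd_refl _ co])
  then have "gcd (d * (m div d)) n = gcd d n"
    by (simp add: gcd_mult_right_right_cancel gcd_mult_left_right_cancel coprime_commute)
  then show ?thesis using assms(1) dn by (simp add: gcd_nat.absorb1)
qed

text \<open>By the Chinese remainder theorem the two divisibility conditions describe a single
  residue class modulo (d e)^2.\<close>

lemma card_square_dvd_split:
  fixes d e a b :: nat
  assumes "coprime d e" "d > 0" "e > 0" "a \<le> b"
  shows "\<bar>real (card {n\<in>{a<..b}. d\<^sup>2 dvd n \<and> e\<^sup>2 dvd n + 1}) - (real b - real a) / real ((d * e)\<^sup>2)\<bar> \<le> 1"
proof -
  have co: "coprime (d\<^sup>2) (e\<^sup>2)" using assms by simp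
  \<comment> \<open>The natural number e^2 - 1 stands for the residue -1; since e > 0, the
    subtraction is not truncated.\<close>
  obtain r where r: "[r = 0] (mod d\<^sup>2)" "[r = e\<^sup>2 - 1] (mod e\<^sup>2)"
    using binary_chinese_remainder_nat[OF co] by blast
  have e2: "e\<^sup>2 - 1 + 1 = e\<^sup>2" using assms by simp
  have "d\<^sup>2 dvd n \<and> e\<^sup>2 dvd n + 1 \<longleftrightarrow> n mod (d * e)\<^sup>2 = r mod (d * e)\<^sup>2" for n
  proof -
    have "d\<^sup>2 dvd n \<longleftrightarrow> [n = r] (mod d\<^sup>2)"
      using r(1) by (metis cong_0_iff cong_sym cong_trans)
    moreover have "e\<^sup>2 dvd n + 1 \<longleftrightarrow> [n = r] (mod e\<^sup>2)"
    proof -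
      have "e\<^sup>2 dvd n + 1 \<longleftrightarrow> [n + 1 = e\<^sup>2 - 1 + 1] (mod e\<^sup>2)"
        unfolding e2 by (simp add: cong_def dvd_eq_mod_eq_0)
      also have "\<dots> \<longleftrightarrow> [n = e\<^sup>2 - 1] (mod e\<^sup>2)" by (rule cong_add_rcancel_nat)
      also have "\<dots> \<longleftrightarrow> [n = r] (mod e\<^sup>2)" using r(2) by (metis cong_sym cong_trans)
      finally show ?thesis .
    qed
    moreover have "[n = r] (mod d\<^sup>2) \<and> [n = r] (mod e\<^sup>2) \<longleftrightarrow> [n = r] (mod d\<^sup>2 * e\<^sup>2)"
      using co coprime_cong_mult_nat cong_modulus_mult_nat by (metis mult.commute)
    ultimately show ?thesis by (simp add: cong_def power_mult_distrib)
  qed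
  then show ?thesis
    using card_residue_class[of "(d * e)\<^sup>2" a b r] assms by simp
qed

text \<open>Every divisor d of m contributes one residue class modulo m^2 and a rounding error of at
  most 1. Squarefreeness of m makes d and m / d coprime.\<close>

lemma card_square_dvd_consecutive:
  fixes m a b :: nat
  assumes "squarefree m" "a \<le> b"
  shows "\<bar>real (card {n\<in>{a<..b}. m\<^sup>2 dvd n * (n + 1)})
           - real (card {d. d dvd m}) * ((real b - real a) / (real m)\<^sup>2)\<bar> \<le> real (card {d. d dvd m})"
proof -
  have m0: "m > 0" using assms(1) not_squarefree_0 by (metis gr0I)
  then have fin: "finite {d. d dvd m}" by simp
  define S where "S d = {n\<in>{a<..b}. d\<^sup>2 dvd n \<and> (m div d)\<^sup>2 dvd n + 1}" for d
  have "{n\<in>{a<..b}. m\<^sup>2 dvd n * (n + 1)} = (\<Union>d\<in>{d. d dvd m}. S d)"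
    unfolding S_def square_dvd_consecutive_iff[OF m0] by blast
  moreover have "card (\<Union>d\<in>{d. d dvd m}. S d) = (\<Sum>d | d dvd m. card (S d))"
  proof (intro card_UN_disjoint fin ballI impI)
    show "finite (S d)" for d by (simp add: S_def)
    show "S d \<inter> S d' = {}" if "d \<in> {d. d dvd m}" "d' \<in> {d. d dvd m}" "d \<noteq> d'" for d d'
      using that gcd_eq_of_square_dvd_consecutive[of _ m] by (auto simp: S_def)
  qed
  ultimately have "real (card {n\<in>{a<..b}. m\<^sup>2 dvd n * (n + 1)}) = (\<Sum>d | d dvd m. real (card (S d)))"
    by simp
  then have "real (card {n\<in>{a<..b}. m\<^sup>2 dvd n * (n + 1)})
           - real (card {d. d dvd m}) * ((real b - real a) / (real m)\<^sup>2)
      = (\<Sum>d | d dvd m. real (card (S d)) - (real b - real a) / (real m)\<^sup>2)"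
    by (simp add: sum_subtractf)
  also have "\<bar>\<dots>\<bar> \<le> (\<Sum>d | d dvd m. \<bar>real (card (S d)) - (real b - real a) / (real m)\<^sup>2\<bar>)"
    by (rule sum_abs)
  also have "\<dots> \<le> (\<Sum>d | d dvd m. 1)"
  proof (rule sum_mono)
    fix d assume "d \<in> {d. d dvd m}"
    then have d: "d dvd m" "d * (m div d) = m" by auto
    have "d > 0" "m div d > 0" using d m0 by (metis gr0I mult_0 mult_0_right)+
    moreover have "coprime d (m div d)" using assms(1) d(2) squarefree_mult_imp_coprime by metis
    ultimately show "\<bar>real (card (S d)) - (real b - real a) / (real m)\<^sup>2\<bar> \<le> 1"
      using card_square_dvd_split[of d "m div d" a b] assms(2) unfolding d(2) S_def by simp
  qed
  finally show ?thesis by simp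
qed

text \<open>The divisors are the products of subsets of the prime factors. This brings tau(m) under
  the bound for 2^omega(m).\<close>

lemma card_divisors_squarefree:
  fixes m :: nat
  assumes "squarefree m"
  shows "card {d. d dvd m} = 2 ^ card (prime_factors m)"
proof -
  have m0: "m > 0" using assms not_squarefree_0 by (metis gr0I)
  have "{d. d dvd m} = {d. squarefree d \<and> prime_factors d \<subseteq> prime_factors m}"
  proof (intro set_eqI iffI; clarsimp)
    fix d assume "d dvd m"
    then show "squarefree d \<and> prime_factors d \<subseteq> prime_factors m"
      using assms m0 by (auto intro: squarefree_mono dest: dvd_prime_factors[rotated])
  next
    fix d assume d: "squarefree d" "prime_factors d \<subseteq> prime_factors m"
    then have "\<Prod>(prime_factors d) dvd \<Prod>(prime_factors m)"
      by (intro prod_dvd_prod_subset) auto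
    then show "d dvd m" using d assms by (simp add: squarefree_eq_prod_prime_factors)
  qed
  moreover have "prime_factors m \<subseteq> Collect prime" by (auto simp: in_prime_factors_iff)
  ultimately show ?thesis using finite_squarefree_primes_in(2) by simp
qed

section \<open>Local densities and the Euler product\<close>

lemma card_dvd_add_interval:
  fixes q A :: nat
  assumes "q > 0"
  shows "card {z\<in>{1..q}. q dvd A + z} = 1"
proof -
  have "{z\<in>{1..q}. q dvd A + z} = {q - A mod q}"
  proof (intro equalityI subsetI)
    fix z assume z: "z \<in> {z\<in>{1..q}. q dvd A + z}"
    then have "q dvd A mod q + z" by (simp add: mod_add_left_eq dvd_eq_mod_eq_0)
    then obtain k where k: "A mod q + z = q * k" by (elim dvdE)
    have "A mod q < q" using assms by simp
    moreover have "1 \<le> z" "z \<le> q" using z by auto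
    \<comment> \<open>A multiple of q strictly between 0 and 2 q can only be q itself.\<close>
    ultimately have "A mod q + z < q * 2" "A mod q + z > q * 0" by linarith+
    then have "k < 2" "0 < k" unfolding k using assms by (simp_all only: mult_less_cancel1)
    then have "k = 1" by simp
    then show "z \<in> {q - A mod q}" using k by simp
  next
    fix z assume "z \<in> {q - A mod q}"
    then have z: "z = q - A mod q" by simp
    have lt: "A mod q < q" using assms by simp
    have "q dvd A mod q + z" using z lt by simp
    then have "q dvd A + z" by (simp add: mod_add_left_eq dvd_eq_mod_eq_0)
    then show "z \<in> {z\<in>{1..q}. q dvd A + z}" using z lt by simp
  qed
  then show ?thesis by simp
qed

text \<open>The variable z occurs linearly, so each of the q^2 pairs (x, y) admits exactly one z,
  and the congruence modulo 1 is vacuous. The constant c below is 1 or 2 according to which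
  congruence remains.\<close>

lemma lambda_star_one:
  assumes "q > 0"
  shows "lambda_star q 1 = q ^ 2" "lambda_star 1 q = q ^ 2"
proof -
  have *: "card {(x, y, z). x \<in> {1..q} \<and> y \<in> {1..q} \<and> z \<in> {1..q} \<and> q dvd x\<^sup>2 + y\<^sup>2 + c + z} = q ^ 2" for c
  proof -
    have "{(x, y, z). x \<in> {1..q} \<and> y \<in> {1..q} \<and> z \<in> {1..q} \<and> q dvd x\<^sup>2 + y\<^sup>2 + c + z}
        = (SIGMA x:{1..q}. SIGMA y:{1..q}. {z\<in>{1..q}. q dvd x\<^sup>2 + y\<^sup>2 + c + z})" by auto
    then have "card {(x, y, z). x \<in> {1..q} \<and> y \<in> {1..q} \<and> z \<in> {1..q} \<and> q dvd x\<^sup>2 + y\<^sup>2 + c + z}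
        = (\<Sum>x\<in>{1..q}. \<Sum>y\<in>{1..q}. card {z\<in>{1..q}. q dvd x\<^sup>2 + y\<^sup>2 + c + z})"
      by (simp only:) (subst card_SigmaI; simp)
    also have "\<dots> = (\<Sum>x\<in>{1..q}. \<Sum>y\<in>{1..q}. 1)"
      by (simp only: card_dvd_add_interval[OF assms])
    finally show ?thesis by (simp add: power2_eq_square)
  qed
  show "lambda_star q 1 = q ^ 2" 
    using *[of 1] by (simp add: lambda_star_def cong_0_iff add_ac)
  show "lambda_star 1 q = q ^ 2" 
    using *[of 2] by (simp add: lambda_star_def cong_0_iff add_ac)
qed

lemma euler_factor_eq:
  "euler_factor p = (if prime p then 1 - 2 / (real p)\<^sup>2 else 1)"
proof (cases "prime p")
  case True
  then have p: "p > 0" by (rule prime_gt_0_nat)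
  have "(real (lambda_star (p\<^sup>2) 1) + real (lambda_star 1 (p\<^sup>2))) / real p ^ 6 = 2 * real p ^ 4 / real p ^ 6"
    using p lambda_star_one[of "p\<^sup>2"] by simp
  also have "\<dots> = 2 / (real p)\<^sup>2" using p by (simp add: field_simps flip: power_add)
  finally show ?thesis using True by (simp add: euler_factor_def)
qed (simp add: euler_factor_def)

text \<open>The deviations 2 / p^2 from 1 are absolutely summable, and no factor vanishes because 2
  / p^2 <= 1/2 for p >= 2.\<close>

lemma convergent_prod_euler_factor: "convergent_prod euler_factor"
proof -
  define z where "z p = (if prime p then - (2 / (real p)\<^sup>2) else 0)" for p :: nat
  have "summable (\<lambda>p. 2 * (1 / (real p)\<^sup>2))"
    using inverse_power_summable[of 2, where 'a = real]
    by (intro summable_mult) (simp add: field_simps)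
  then have "summable (\<lambda>p. \<bar>z p\<bar>)"
    by (rule summable_comparison_test'[where N = 0]) (auto simp: z_def)
  moreover have "z p \<noteq> -1" for p
  proof (cases "prime p")
    case True
    then have "2 \<le> real p" using prime_ge_2_nat by fastforce
    then have "2\<^sup>2 \<le> (real p)\<^sup>2" by (intro power_mono) auto
    then have "2 / (real p)\<^sup>2 < 1" by (simp add: divide_less_eq)
    then show ?thesis using True by (simp add: z_def)
  qed (simp add: z_def)
  ultimately have "convergent_prod (\<lambda>p. 1 + z p)" by (rule summable_imp_convergent_prod_real)
  moreover have "(\<lambda>p. 1 + z p) = euler_factor" by (auto simp: z_def euler_factor_eq)
  ultimately show ?thesis by simp
qed

text \<open>For squarefree m this is mu(m) times the density of the n with m^2 dvd n (n +
  1).\<close>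

definition euler_coeff :: "nat \<Rightarrow> real" where
  "euler_coeff m = of_int (moebius_mu m) * real (card {d. d dvd m}) / (real m)\<^sup>2"

lemma abs_euler_coeff_le: "\<bar>euler_coeff m\<bar> \<le> real (card {d. d dvd m}) / (real m)\<^sup>2"
proof -
  have "\<bar>real_of_int (moebius_mu m)\<bar> \<le> 1" using abs_moebius_mu_le[of m] by linarith
  then have "\<bar>real_of_int (moebius_mu m)\<bar> * (real (card {d. d dvd m}) / (real m)\<^sup>2)
      \<le> 1 * (real (card {d. d dvd m}) / (real m)\<^sup>2)"
    by (intro mult_right_mono) auto
  then show ?thesis by (simp add: euler_coeff_def abs_mult)
qed

lemma euler_coeff_squarefree:
  assumes "squarefree m"
  shows "euler_coeff m = (\<Prod>p\<in>prime_factors m. - 2 / (real p)\<^sup>2)"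
proof -
  have "(\<Prod>p\<in>prime_factors m. - 2 / (real p)\<^sup>2)
      = (-1) ^ card (prime_factors m) * 2 ^ card (prime_factors m) / (real (\<Prod>(prime_factors m)))\<^sup>2"
    by (simp only: prod_dividef prod_power_distrib prod_constant of_nat_prod flip: power_mult_distrib) simp
  also have "\<dots> = euler_coeff m"
    using assms by (simp add: euler_coeff_def moebius_mu_def card_divisors_squarefree
      squarefree_eq_prod_prime_factors)
  finally show ?thesis ..
qed

lemma prod_euler_factor_eq:
  "(\<Prod>p\<le>N. euler_factor p)
     = (\<Sum>m | squarefree m \<and> prime_factors m \<subseteq> {p. p \<le> N \<and> prime p}. euler_coeff m)"
proof -
  let ?Q = "{p. p \<le> N \<and> prime p}"
  have "(\<Prod>p\<le>N. euler_factor p) = (\<Prod>p\<in>?Q. 1 + - 2 / (real p)\<^sup>2)"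
    by (intro prod.mono_neutral_cong_right) (auto simp: euler_factor_eq)
  also have "\<dots> = (\<Sum>m | squarefree m \<and> prime_factors m \<subseteq> ?Q. \<Prod>p\<in>prime_factors m. - 2 / (real p)\<^sup>2)"
    by (intro sum_squarefree_eq_prod[symmetric]) auto
  also have "\<dots> = (\<Sum>m | squarefree m \<and> prime_factors m \<subseteq> ?Q. euler_coeff m)"
    by (intro sum.cong) (auto simp: euler_coeff_squarefree)
  finally show ?thesis .
qed

text \<open>The partial product up to N is the sum over the finite set \<open>A N\<close>. These
  sets exhaust the squarefree numbers, so partial products and the unordered sum have the same
  limit.\<close>

lemma prodinf_euler_factor_eq:
  assumes "(\<lambda>m. \<bar>euler_coeff m\<bar>) summable_on {m. squarefree m}"
  shows "(\<Prod>p. euler_factor p) = infsum euler_coeff {m. squarefree m}"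
proof -
  define A where "A N = {m :: nat. squarefree m \<and> prime_factors m \<subseteq> {p. p \<le> N \<and> prime p}}" for N
  have fin: "finite (A N)" for N
    unfolding A_def by (rule finite_squarefree_primes_in(1)) auto
  have "(euler_coeff has_sum infsum euler_coeff {m. squarefree m}) {m. squarefree m}"
    
    by (rule has_sum_infsum, rule abs_summable_summable) (use assms in simp)
  then have "(sum euler_coeff \<longlongrightarrow> infsum euler_coeff {m. squarefree m}) (finite_subsets_at_top {m. squarefree m})"
    by (simp add: has_sum_def)
  \<comment> \<open>A finite set of squarefree numbers lies in \<open>A N\<close> once N is at least
    every prime occurring in it.\<close>
  moreover have "filterlim A (finite_subsets_at_top {m. squarefree m}) sequentially"
    unfolding filterlim_finite_subsets_at_top
  proof (intro allI impI)
    fix X :: "nat set" assume X: "finite X \<and> X \<subseteq> {m. squarefree m}"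
    have "finite (\<Union>m\<in>X. prime_factors m)" using X by simp
    then obtain N0 where N0: "\<And>p. p \<in> (\<Union>m\<in>X. prime_factors m) \<Longrightarrow> p \<le> N0"
      using finite_nat_set_iff_bounded_le by metis
    have "X \<subseteq> A N" if "N \<ge> N0" for N
    proof
      fix m assume m: "m \<in> X"
      have "p \<le> N" if "p \<in> prime_factors m" for p using N0[of p] m that \<open>N \<ge> N0\<close> by force
      then show "m \<in> A N" using m X by (auto simp: A_def in_prime_factors_iff)
    qed
    then show "\<forall>\<^sub>F N in sequentially. finite (A N) \<and> X \<subseteq> A N \<and> A N \<subseteq> {m. squarefree m}"
      using fin by (intro eventually_sequentiallyI[of N0]) (auto simp: A_def)
  qed
  ultimately have "(\<lambda>N. sum euler_coeff (A N)) \<longlonglongrightarrow> infsum euler_coeff {m. squarefree m}"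
    by (rule filterlim_compose)
  moreover have "(\<lambda>N. sum euler_coeff (A N)) \<longlonglongrightarrow> (\<Prod>p. euler_factor p)"
    using convergent_prod_LIMSEQ[OF convergent_prod_euler_factor]
    by (simp add: prod_euler_factor_eq A_def)
  ultimately show ?thesis by (rule LIMSEQ_unique[rotated])
qed

section \<open>Representations of n as x^2 + y^2 + z + 1\<close>

text \<open>If y0 is the least solution and y = y0 + j another, then y^2 - y0^2 = j (y + y0) >= j x.
  Both squares lie in an interval of length h, which forces j <= h / x.\<close>

lemma card_squares_in_interval:
  fixes x h T :: nat
  assumes "x > 0"
  shows "real (card {y\<in>{x..h}. y\<^sup>2 < T \<and> T \<le> y\<^sup>2 + h}) \<le> 1 + real h / real x"
proof (cases "{y\<in>{x..h}. y\<^sup>2 < T \<and> T \<le> y\<^sup>2 + h} = {}")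
  case False
  define Y where "Y = {y\<in>{x..h}. y\<^sup>2 < T \<and> T \<le> y\<^sup>2 + h}"
  define y0 where "y0 = Min Y"
  have fin: "finite Y" by (simp add: Y_def)
  have y0: "y0 \<in> Y" using False fin unfolding y0_def Y_def by (intro Min_in)
  have "Y \<subseteq> {y0..y0 + h div x}"
  proof
    fix y assume y: "y \<in> Y"
    have le: "y0 \<le> y" using fin y unfolding y0_def by simp
    then obtain j where j: "y = y0 + j" using le_Suc_ex by blast
    have "j * x \<le> j * y" using y by (simp add: Y_def)
    also have "\<dots> \<le> y\<^sup>2 - y0\<^sup>2" unfolding j by (simp add: power2_eq_square algebra_simps)
    also have "\<dots> \<le> h" using y y0 by (auto simp: Y_def)
    finally have "j \<le> h div x" using assms by (simp add: less_eq_div_iff_mult_less_eq)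
    then show "y \<in> {y0..y0 + h div x}" using j by simp
  qed
  then have "card Y \<le> h div x + 1" using card_mono[of "{y0..y0 + h div x}" Y] by simp
  then have "real (card Y) \<le> real (h div x) + 1" by linarith
  also have "\<dots> \<le> real h / real x + 1" using of_nat_div_le_of_nat[of h x, where ?'a = real] by simp
  finally show ?thesis by (simp add: Y_def)
next
  case True
  then show ?thesis by (simp only: card.empty) simp
qed

text \<open>The pair (x, y) determines z, and the range of z confines y^2 to an interval of length
  h. The factor 2 accounts for x <= y and y <= x.\<close>

lemma card_representations_le:
  fixes n h :: nat
  shows "real (card {(x, y, z). x \<in> {1..h} \<and> y \<in> {1..h} \<and> z \<in> {1..h} \<and> x\<^sup>2 + y\<^sup>2 + z + 1 = n})
    \<le> 2 * (\<Sum>x\<in>{1..h}. 1 + real h / real x)"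
proof -
  define R where "R = {(x, y, z). x \<in> {1..h} \<and> y \<in> {1..h} \<and> z \<in> {1..h} \<and> x\<^sup>2 + y\<^sup>2 + z + 1 = n}"
  define P where "P = (SIGMA x:{1..h}. {y\<in>{x..h}. x\<^sup>2 + y\<^sup>2 + 1 < n \<and> n \<le> x\<^sup>2 + y\<^sup>2 + 1 + h})"
  have finP: "finite P" by (simp add: P_def)
  have sub: "(\<lambda>(x, y, z). (x, y)) ` R \<subseteq> P \<union> prod.swap ` P"
  proof (rule image_subsetI)
    fix t assume "t \<in> R"
    then obtain x y z where t: "t = (x, y, z)" "x \<in> {1..h}" "y \<in> {1..h}" "z \<in> {1..h}" "x\<^sup>2 + y\<^sup>2 + z + 1 = n"
      by (auto simp: R_def)
    have "(x, y) \<in> P \<or> (y, x) \<in> P" using t(2-5) by (auto simp: P_def)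
    moreover have "prod.swap (y, x) = (x, y)" by simp
    ultimately have "(x, y) \<in> P \<union> prod.swap ` P" by (metis UnI1 UnI2 image_eqI)
    then show "(case t of (x, y, z) \<Rightarrow> (x, y)) \<in> P \<union> prod.swap ` P" using t(1) by simp
  qed
  have "inj_on (\<lambda>(x, y, z). (x, y)) R" by (auto simp: inj_on_def R_def)
  then have "card R = card ((\<lambda>(x, y, z). (x, y)) ` R)" by (rule card_image[symmetric])
  also have "\<dots> \<le> card (P \<union> prod.swap ` P)"
    by (rule card_mono[OF _ sub]) (simp add: finP)
  also have "\<dots> \<le> card P + card (prod.swap ` P)" by (rule card_Un_le)
  also have "\<dots> \<le> 2 * card P" using card_image_le[OF finP, of prod.swap] by simp
  finally have "real (card R) \<le> 2 * real (card P)" by simp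
  also have "real (card P) = (\<Sum>x\<in>{1..h}. real (card {y\<in>{x..h}. x\<^sup>2 + y\<^sup>2 + 1 < n \<and> n \<le> x\<^sup>2 + y\<^sup>2 + 1 + h}))"
    unfolding P_def by (subst card_SigmaI) auto
  also have "\<dots> \<le> (\<Sum>x\<in>{1..h}. 1 + real h / real x)"
  proof (rule sum_mono)
    fix x assume x: "x \<in> {1..h}"
    \<comment> \<open>Truncated subtraction is harmless: if n <= x^2 + 1, the bound is 0 and both
      sets are empty.\<close>
    have "{y\<in>{x..h}. x\<^sup>2 + y\<^sup>2 + 1 < n \<and> n \<le> x\<^sup>2 + y\<^sup>2 + 1 + h}
        = {y\<in>{x..h}. y\<^sup>2 < n - 1 - x\<^sup>2 \<and> n - 1 - x\<^sup>2 \<le> y\<^sup>2 + h}"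
      by auto
    then show "real (card {y\<in>{x..h}. x\<^sup>2 + y\<^sup>2 + 1 < n \<and> n \<le> x\<^sup>2 + y\<^sup>2 + 1 + h}) \<le> 1 + real h / real x"
      using card_squares_in_interval[of x h "n - 1 - x\<^sup>2"] x by simp
  qed
  finally show ?thesis by (simp add: R_def)
qed

section \<open>Head and tail sums of the divisor function\<close>

text \<open>Fixing \<delta> and K once keeps all later constants explicit and independent of h. The
  upper bound on \<delta> makes exponents such as -1/2 + \<delta> negative.\<close>

locale divisor_bound =
  fixes \<delta> K :: real
  assumes delta: "0 < \<delta>" "\<delta> < 1 / 4"
    and K_pos: "K > 0"
    and two_power_omega: "\<And>n::nat. n > 0 \<Longrightarrow> 2 ^ card (prime_factors n) \<le> K * real n powr \<delta>"
begin

text \<open>This is zeta(1 + \<delta>), since the index 0 contributes \<open>0 powr _\<close>, which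
  is 0.\<close>

definition W :: real where "W = (\<Sum>n. real n powr (-1 - \<delta>))"

lemma sum_powr_le_W:
  assumes "finite F"
  shows "(\<Sum>n\<in>F. real n powr (-1 - \<delta>)) \<le> W"
  unfolding W_def using delta assms by (intro sum_le_suminf) (auto simp: summable_real_powr_iff)

lemma W_nonneg: "W \<ge> 0"
  using sum_powr_le_W[of "{}"] by simp

lemma sum_powr_tail_le:
  assumes "finite F" "h > 0" "\<And>m. m \<in> F \<Longrightarrow> h < m\<^sup>2"
  shows "(\<Sum>m\<in>F. real m powr (-2 + \<delta>)) \<le> W * real h powr (-1/2 + \<delta>)"
proof -
  have "(\<Sum>m\<in>F. real m powr (-2 + \<delta>)) \<le> (\<Sum>m\<in>F. real m powr (-1 - \<delta>) * real h powr (-1/2 + \<delta>))"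
  proof (rule sum_mono)
    fix m assume "m \<in> F"
    then have m: "h < m\<^sup>2" by (rule assms)
    then have m0: "m > 0" by (cases m) auto
    \<comment> \<open>Rankin's trick\<close>
    have "-2 + \<delta> = (-1 - \<delta>) + 2 * (-1/2 + \<delta>)" by simp
    then have "real m powr (-2 + \<delta>) = real m powr (-1 - \<delta>) * real m powr (2 * (-1/2 + \<delta>))"
      by (simp only: powr_add)
    also have "real m powr (2 * (-1/2 + \<delta>)) = (real (m\<^sup>2)) powr (-1/2 + \<delta>)"
      unfolding powr_powr[symmetric] using m0 by (simp add: powr_numeral)
    also have "\<dots> \<le> real h powr (-1/2 + \<delta>)"
    proof (rule powr_mono2')
      show "-1/2 + \<delta> \<le> 0" using delta by simp
      show "0 < real h" using assms(2) by simp
      show "real h \<le> real (m\<^sup>2)" using m by (simp only: of_nat_le_iff)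
    qed
    finally show "real m powr (-2 + \<delta>) \<le> real m powr (-1 - \<delta>) * real h powr (-1/2 + \<delta>)"
      by (simp add: mult_left_mono)
  qed
  also have "\<dots> = (\<Sum>m\<in>F. real m powr (-1 - \<delta>)) * real h powr (-1/2 + \<delta>)"
    by (simp add: sum_distrib_right)
  also have "\<dots> \<le> W * real h powr (-1/2 + \<delta>)"
    by (intro mult_right_mono sum_powr_le_W assms) auto
  finally show ?thesis .
qed

lemma card_divisors_le:
  assumes "squarefree m"
  shows "real (card {d. d dvd m}) \<le> K * real m powr \<delta>"
proof -
  have "m > 0" using assms not_squarefree_0 by (metis gr0I)
  then show ?thesis using two_power_omega[of m] by (simp add: card_divisors_squarefree assms)
qed

lemma card_divisors_over_square_le:
  assumes "squarefree m"
  shows "real (card {d. d dvd m}) / (real m)\<^sup>2 \<le> K * real m powr (-2 + \<delta>)"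
proof -
  have m: "m > 0" using assms not_squarefree_0 by (metis gr0I)
  have "real (card {d. d dvd m}) / (real m)\<^sup>2 \<le> K * real m powr \<delta> / (real m)\<^sup>2"
    by (intro divide_right_mono card_divisors_le assms) auto
  also have "\<dots> = K * real m powr (-2 + \<delta>)"
  proof -
    have "real m powr (-2) = 1 / (real m)\<^sup>2" using m by (simp add: powr_minus_divide powr_numeral)
    then show ?thesis by (simp only: powr_add) simp
  qed
  finally show ?thesis .
qed

lemma sum_divisors_tail_le:
  assumes "finite F" "h > 0" "\<And>m. m \<in> F \<Longrightarrow> squarefree m \<and> h < m\<^sup>2"
  shows "(\<Sum>m\<in>F. real (card {d. d dvd m}) / (real m)\<^sup>2) \<le> K * W * real h powr (-1/2 + \<delta>)"
proof -
  have "(\<Sum>m\<in>F. real (card {d. d dvd m}) / (real m)\<^sup>2) \<le> K * (\<Sum>m\<in>F. real m powr (-2 + \<delta>))"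
    unfolding sum_distrib_left using assms by (intro sum_mono card_divisors_over_square_le) auto
  also have "\<dots> \<le> K * (W * real h powr (-1/2 + \<delta>))"
    using assms K_pos by (intro mult_left_mono sum_powr_tail_le) auto
  finally show ?thesis by simp
qed

text \<open>There are at most h^(1/2) such m, and each satisfies m <= m^2 <= h, so that tau(m) <= K
  h^\<delta>.\<close>

lemma sum_divisors_head_le:
  assumes "h > 0"
  shows "(\<Sum>m | squarefree m \<and> m\<^sup>2 \<le> h. real (card {d. d dvd m})) \<le> K * real h powr (1/2 + \<delta>)"
proof -
  let ?M = "{m. squarefree m \<and> m\<^sup>2 \<le> h}"
  have le: "real m \<le> real h powr (1/2)" if "m\<^sup>2 \<le> h" for m
  proof -
    have "(real m)\<^sup>2 \<le> real h" using that by (simp only: of_nat_power[symmetric] of_nat_le_iff)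
    then have "real m \<le> sqrt (real h)" by (rule real_le_rsqrt)
    then show ?thesis by (simp only: powr_half_sqrt of_nat_0_le_iff)
  qed
  have sub: "?M \<subseteq> {1..nat \<lfloor>real h powr (1/2)\<rfloor>}"
  proof
    fix m assume m: "m \<in> ?M"
    then have "m \<noteq> 0" using not_squarefree_0 by (metis mem_Collect_eq)
    then show "m \<in> {1..nat \<lfloor>real h powr (1/2)\<rfloor>}" using le[of m] m by (simp add: le_nat_floor)
  qed
  have "(\<Sum>m\<in>?M. real (card {d. d dvd m})) \<le> (\<Sum>m\<in>?M. K * real h powr \<delta>)"
  proof (rule sum_mono)
    fix m assume m: "m \<in> ?M"
    have "m * 1 \<le> m\<^sup>2" unfolding power2_eq_square by (cases m) auto
    then have "real m \<le> real h" using m by simp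
    then have "K * real m powr \<delta> \<le> K * real h powr \<delta>"
      using delta K_pos by (intro mult_left_mono powr_mono2) auto
    then show "real (card {d. d dvd m}) \<le> K * real h powr \<delta>"
      using card_divisors_le[of m] m by simp
  qed
  also have "\<dots> = real (card ?M) * (K * real h powr \<delta>)" by simp
  also have "\<dots> \<le> real h powr (1/2) * (K * real h powr \<delta>)"
  proof (rule mult_right_mono)
    have "card ?M \<le> nat \<lfloor>real h powr (1/2)\<rfloor>"
      using card_mono[OF finite_atLeastAtMost sub] by simp
    then have "real (card ?M) \<le> real (nat \<lfloor>real h powr (1/2)\<rfloor>)" by (simp only: of_nat_le_iff)
    also have "\<dots> \<le> real h powr (1/2)" by simp
    finally show "real (card ?M) \<le> real h powr (1/2)" .
    show "0 \<le> K * real h powr \<delta>" using K_pos by simp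
  qed
  also have "\<dots> = K * real h powr (1/2 + \<delta>)" by (simp only: powr_add mult_ac)
  finally show ?thesis .
qed

end

section \<open>The truncated Moebius sum and its exceptional integers\<close>

text \<open>Only at these n can discarding the moduli with m^2 > h change the Moebius sum for n (n +
  1).\<close>

definition bad_set :: "nat \<Rightarrow> nat \<Rightarrow> nat set" where
  "bad_set h L = {n\<in>{0<..L}. \<exists>m. squarefree m \<and> h < m\<^sup>2 \<and> m\<^sup>2 dvd n * (n + 1)}"

definition small_sum :: "nat \<Rightarrow> nat \<Rightarrow> int" where
  "small_sum h n = (\<Sum>m | squarefree m \<and> m\<^sup>2 \<le> h. if m\<^sup>2 dvd n * (n + 1) then moebius_mu m else 0)"

lemma finite_square_le: "finite {m::nat. squarefree m \<and> m\<^sup>2 \<le> h}"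
proof (rule finite_subset)
  have "m \<le> m\<^sup>2" for m :: nat unfolding power2_eq_square by (cases m) auto
  then show "{m::nat. squarefree m \<and> m\<^sup>2 \<le> h} \<subseteq> {..h}" using le_trans by blast
qed simp

context divisor_bound
begin

text \<open>Finite partial sums are at most K W, because tau(m) / m^2 <= K m^(-2 + \<delta>) <= K
  m^(-1 - \<delta>).\<close>

lemma summable_euler_coeff: "(\<lambda>m. \<bar>euler_coeff m\<bar>) summable_on {m. squarefree m}"
proof (rule nonneg_bdd_above_summable_on)
  have "sum (\<lambda>m. \<bar>euler_coeff m\<bar>) F \<le> K * W" if F: "finite F" "F \<subseteq> {m. squarefree m}" for F
  proof -
    have "sum (\<lambda>m. \<bar>euler_coeff m\<bar>) F \<le> (\<Sum>m\<in>F. K * real m powr (-1 - \<delta>))"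
    proof (rule sum_mono)
      fix m assume "m \<in> F"
      then have m: "squarefree m" using F by blast
      then have "m > 0" using not_squarefree_0 by (metis gr0I)
      then have "real m powr (-2 + \<delta>) \<le> real m powr (-1 - \<delta>)"
        using delta by (intro powr_mono) auto
      then have "K * real m powr (-2 + \<delta>) \<le> K * real m powr (-1 - \<delta>)"
        using K_pos by (intro mult_left_mono) auto
      then show "\<bar>euler_coeff m\<bar> \<le> K * real m powr (-1 - \<delta>)"
        using abs_euler_coeff_le[of m] card_divisors_over_square_le[OF m] by linarith
    qed
    also have "\<dots> \<le> K * W"
      unfolding sum_distrib_left[symmetric] using K_pos F by (intro mult_left_mono sum_powr_le_W) auto
    finally show ?thesis .
  qed
  then show "bdd_above (sum (\<lambda>m. \<bar>euler_coeff m\<bar>) ` {F. F \<subseteq> {m. squarefree m} \<and> finite F})"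
    by (intro bdd_aboveI[of _ "K * W"]) blast
qed simp

text \<open>The difference is the sum over squarefree m with m^2 > h, which is bounded through its
  finite subsums.\<close>

lemma sum_euler_coeff_approx:
  assumes "h > 0"
  shows "\<bar>(\<Sum>m | squarefree m \<and> m\<^sup>2 \<le> h. euler_coeff m) - (\<Prod>p. euler_factor p)\<bar>
    \<le> K * W * real h powr (-1/2 + \<delta>)"
proof -
  let ?S = "{m::nat. squarefree m}" and ?M = "{m::nat. squarefree m \<and> m\<^sup>2 \<le> h}"
  have sub: "?M \<subseteq> ?S" by blast
  have abs: "(\<lambda>m. \<bar>euler_coeff m\<bar>) summable_on (?S - ?M)"
    by (rule summable_on_subset_banach[OF summable_euler_coeff]) blast
  have summ: "euler_coeff summable_on ?S"
    by (rule abs_summable_summable) (use summable_euler_coeff in simp)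
  have "(\<Prod>p. euler_factor p) = infsum euler_coeff ?S"
    by (rule prodinf_euler_factor_eq[OF summable_euler_coeff])
  moreover have "infsum euler_coeff (?S - ?M) = infsum euler_coeff ?S - infsum euler_coeff ?M"
    by (rule infsum_Diff[OF summ summable_on_finite[OF finite_square_le] sub])
  moreover have "infsum euler_coeff ?M = sum euler_coeff ?M"
    by (rule infsum_finite[OF finite_square_le])
  ultimately have "\<bar>(\<Sum>m\<in>?M. euler_coeff m) - (\<Prod>p. euler_factor p)\<bar> = \<bar>infsum euler_coeff (?S - ?M)\<bar>"
    by linarith
  also have "\<dots> \<le> infsum (\<lambda>m. \<bar>euler_coeff m\<bar>) (?S - ?M)"
    using norm_infsum_bound[of euler_coeff "?S - ?M"] abs by (simp only: real_norm_def)
  also have "\<dots> \<le> K * W * real h powr (-1/2 + \<delta>)"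
  proof (rule infsum_le_finite_sums[OF abs])
    fix F assume F: "finite F" "F \<subseteq> ?S - ?M"
    have "(\<Sum>m\<in>F. \<bar>euler_coeff m\<bar>) \<le> (\<Sum>m\<in>F. real (card {d. d dvd m}) / (real m)\<^sup>2)"
      by (intro sum_mono abs_euler_coeff_le)
    also have "\<dots> \<le> K * W * real h powr (-1/2 + \<delta>)"
      using F assms by (intro sum_divisors_tail_le) (auto simp: not_le)
    finally show "(\<Sum>m\<in>F. \<bar>euler_coeff m\<bar>) \<le> K * W * real h powr (-1/2 + \<delta>)" .
  qed
  finally show ?thesis .
qed

text \<open>Two errors arise: rounding costs at most tau(m) for each m with m^2 <= h, and completing
  the series costs h times its tail. The cutoff m^2 <= h balances them, both being of order h^(1/2 +
  \<delta>).\<close>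

lemma sum_small_sum_approx:
  assumes "h > 0"
  shows "\<bar>of_int (\<Sum>n\<in>{A<..A+h}. small_sum h n) - real h * (\<Prod>p. euler_factor p)\<bar>
    \<le> K * (1 + W) * real h powr (1/2 + \<delta>)"
proof -
  let ?M = "{m::nat. squarefree m \<and> m\<^sup>2 \<le> h}"
  let ?c = "\<lambda>m. real (card {n\<in>{A<..A+h}. m\<^sup>2 dvd n * (n + 1)})"
  let ?e = "\<lambda>m. real h * euler_coeff m"
  have "(\<Sum>n\<in>{A<..A+h}. small_sum h n)
      = (\<Sum>m\<in>?M. \<Sum>n\<in>{A<..A+h}. if m\<^sup>2 dvd n * (n + 1) then moebius_mu m else 0)"
    unfolding small_sum_def by (rule sum.swap)
  also have "\<dots> = (\<Sum>m\<in>?M. moebius_mu m * int (card {n\<in>{A<..A+h}. m\<^sup>2 dvd n * (n + 1)}))"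
    by (intro sum.cong refl) (simp add: sum.If_cases Int_def)
  finally have "of_int (\<Sum>n\<in>{A<..A+h}. small_sum h n) = (\<Sum>m\<in>?M. of_int (moebius_mu m) * ?c m)"
    by simp
  then have eq: "of_int (\<Sum>n\<in>{A<..A+h}. small_sum h n) - (\<Sum>m\<in>?M. ?e m)
      = (\<Sum>m\<in>?M. of_int (moebius_mu m) * ?c m - ?e m)"
    by (simp only: sum_subtractf)
  have "\<bar>\<Sum>m\<in>?M. of_int (moebius_mu m) * ?c m - ?e m\<bar>
      \<le> (\<Sum>m\<in>?M. \<bar>of_int (moebius_mu m) * ?c m - ?e m\<bar>)" by (rule sum_abs)
  also have "\<dots> \<le> (\<Sum>m\<in>?M. real (card {d. d dvd m}))"
  proof (rule sum_mono)
    fix m assume m: "m \<in> ?M"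
    let ?t = "real (card {d. d dvd m})"
    have eq: "of_int (moebius_mu m) * ?c m - ?e m = of_int (moebius_mu m) * (?c m - ?t * (real h / (real m)\<^sup>2))"
      unfolding euler_coeff_def right_diff_distrib by (simp only: times_divide_eq_left times_divide_eq_right mult_ac)
    have "\<bar>of_int (moebius_mu m)\<bar> * \<bar>?c m - ?t * (real h / (real m)\<^sup>2)\<bar> \<le> 1 * ?t"
    proof (rule mult_mono)
      show "\<bar>real_of_int (moebius_mu m)\<bar> \<le> 1" using abs_moebius_mu_le[of m] by linarith
      show "\<bar>?c m - ?t * (real h / (real m)\<^sup>2)\<bar> \<le> ?t"
        using card_square_dvd_consecutive[of m A "A + h"] m by simp
    qed auto
    then show "\<bar>of_int (moebius_mu m) * ?c m - ?e m\<bar> \<le> ?t" unfolding eq abs_mult by simp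
  qed
  also have "\<dots> \<le> K * real h powr (1/2 + \<delta>)" by (rule sum_divisors_head_le[OF assms])
  finally have 1: "\<bar>of_int (\<Sum>n\<in>{A<..A+h}. small_sum h n) - (\<Sum>m\<in>?M. ?e m)\<bar> \<le> K * real h powr (1/2 + \<delta>)"
    unfolding eq .
  have "\<bar>(\<Sum>m\<in>?M. ?e m) - real h * (\<Prod>p. euler_factor p)\<bar>
      = real h * \<bar>(\<Sum>m\<in>?M. euler_coeff m) - (\<Prod>p. euler_factor p)\<bar>"
    by (simp add: abs_mult flip: sum_distrib_left right_diff_distrib)
  also have "\<dots> \<le> real h * (K * W * real h powr (-1/2 + \<delta>))"
    by (intro mult_left_mono sum_euler_coeff_approx assms) simp
  also have "\<dots> = K * W * (real h powr 1 * real h powr (-1/2 + \<delta>))" using assms by simp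
  also have "\<dots> = K * W * real h powr (1/2 + \<delta>)" by (subst powr_add[symmetric]) simp
  finally have "\<bar>of_int (\<Sum>n\<in>{A<..A+h}. small_sum h n) - real h * (\<Prod>p. euler_factor p)\<bar>
      \<le> K * real h powr (1/2 + \<delta>) + K * W * real h powr (1/2 + \<delta>)" using 1 by linarith
  also have "\<dots> = K * (1 + W) * real h powr (1/2 + \<delta>)" by (simp only: distrib_left distrib_right mult_1_right)
  finally show ?thesis .
qed

text \<open>The complete Moebius sum equals the indicator, so the difference is the sum of mu over
  the square divisors with m^2 > h. That set is empty unless n is bad, and has at most 2^omega(n (n
  + 1)) elements.\<close>

lemma small_sum_approx:
  assumes "n > 0" "n \<le> L"
  shows "\<bar>of_bool (squarefree (n * (n + 1))) - real_of_int (small_sum h n)\<bar>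
    \<le> (if n \<in> bad_set h L then K * real (n * (n + 1)) powr \<delta> else 0)"
proof -
  let ?N = "n * (n + 1)"
  have N: "?N > 0" using assms by simp
  note sd = square_divisors_moebius_inversion[OF N]
  define S B where "S = {m\<in>square_divisors ?N. m\<^sup>2 \<le> h}" and "B = {m\<in>square_divisors ?N. h < m\<^sup>2}"
  have "small_sum h n = (\<Sum>m\<in>S. moebius_mu m)"
    unfolding small_sum_def S_def square_divisors_def
    by (rule sum.mono_neutral_cong_right) (use finite_square_le in auto)
  moreover have "(\<Sum>m\<in>square_divisors ?N. moebius_mu m) = (\<Sum>m\<in>S. moebius_mu m) + (\<Sum>m\<in>B. moebius_mu m)"
    using sd(1) by (subst sum.union_disjoint[symmetric]) (auto simp: S_def B_def intro!: sum.cong)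
  ultimately have "of_bool (squarefree ?N) - small_sum h n = (\<Sum>m\<in>B. moebius_mu m)"
    using sd(3) by simp
  then have eq: "of_bool (squarefree ?N) - real_of_int (small_sum h n) = of_int (\<Sum>m\<in>B. moebius_mu m)"
    by (metis of_int_diff of_int_of_bool)
  show ?thesis
  proof (cases "n \<in> bad_set h L")
    case True
    have "\<bar>\<Sum>m\<in>B. moebius_mu m\<bar> \<le> (\<Sum>m\<in>B. \<bar>moebius_mu m\<bar>)" by (rule sum_abs)
    also have "\<dots> \<le> (\<Sum>m\<in>B. 1)" by (intro sum_mono abs_moebius_mu_le)
    also have "\<dots> = int (card B)" by simp
    also have "\<dots> \<le> int (card (square_divisors ?N))"
      using sd(1) by (simp add: B_def card_mono)
    also have "\<dots> \<le> int (2 ^ card (prime_factors ?N))" using sd(2) by (simp only: of_nat_le_iff)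
    finally have "real_of_int \<bar>\<Sum>m\<in>B. moebius_mu m\<bar> \<le> real_of_int (int (2 ^ card (prime_factors ?N)))"
      by (simp only: of_int_le_iff)
    also have "\<dots> \<le> K * real ?N powr \<delta>" using two_power_omega[OF N] by simp
    finally show ?thesis using True eq by simp
  next
    case False
    then have "B = {}" using assms by (auto simp: B_def bad_set_def square_divisors_def)
    then show ?thesis using False eq by simp
  qed
qed

lemma card_bad_set_le:
  assumes "h > 0" "h\<^sup>2 \<le> L"
  shows "real (card (bad_set h L)) \<le> (6 + 2 * K) * W * real L * real h powr (-1/2 + \<delta>)"
proof -
  have L1: "L \<ge> 1" using assms by (metis One_nat_def Suc_leI le_trans zero_less_power)
  \<comment> \<open>Write \<open>m = d * e\<close> with \<open>d\<^sup>2 dvd n\<close> and \<open>e\<^sup>2 dvd n + 1\<close>. If \<open>d\<^sup>2\<close> or \<open>e\<^sup>2\<close> exceeds \<open>h\<close>, it alone makes \<open>n\<close> rare;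
    otherwise \<open>m\<^sup>2 \<le> h\<^sup>2 \<le> L\<close>, so that the count for the modulus \<open>m\<^sup>2\<close> is dominated by its main term.\<close>
  define U where "U = {d::nat. h < d\<^sup>2 \<and> d\<^sup>2 \<le> L + 1}"
  define V where "V = {m::nat. squarefree m \<and> h < m\<^sup>2 \<and> m\<^sup>2 \<le> h\<^sup>2}"
  \<comment> \<open>The limit \<open>L + 1\<close> in \<open>U\<close> allows for e^2 dividing n +
    1. The vacuous conditions with \<open>1\<^sup>2\<close> give \<open>E1\<close> and
    \<open>E2\<close> the shape of \<open>card_square_dvd_split\<close>.\<close>
  define E1 where "E1 d = {n\<in>{0<..L}. d\<^sup>2 dvd n \<and> 1\<^sup>2 dvd n + 1}" for d
  define E2 where "E2 d = {n\<in>{0<..L}. 1\<^sup>2 dvd n \<and> d\<^sup>2 dvd n + 1}" for d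
  define E3 where "E3 m = {n\<in>{0<..L}. m\<^sup>2 dvd n * (n + 1)}" for m
  define T where "T = real h powr (-1/2 + \<delta>)"
  have sq: "m \<le> m\<^sup>2" for m :: nat unfolding power2_eq_square by (cases m) auto
  have finU: "finite U"
    by (rule finite_subset[of _ "{..L + 1}"]) (auto simp: U_def intro: le_trans[OF sq])
  have finV: "finite V"
    by (rule finite_subset[of _ "{..h\<^sup>2}"]) (auto simp: V_def intro: le_trans[OF sq])
  have "bad_set h L \<subseteq> (\<Union>d\<in>U. E1 d) \<union> (\<Union>d\<in>U. E2 d) \<union> (\<Union>m\<in>V. E3 m)"
  proof
    fix n assume "n \<in> bad_set h L"
    then obtain m where n: "n \<in> {0<..L}" and m: "squarefree m" "h < m\<^sup>2" "m\<^sup>2 dvd n * (n + 1)"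
      by (auto simp: bad_set_def)
    have "m > 0" using m(1) not_squarefree_0 by (metis gr0I)
    then obtain d where d: "d dvd m" "d\<^sup>2 dvd n" "(m div d)\<^sup>2 dvd n + 1"
      using m(3) square_dvd_consecutive_iff by blast
    define e where "e = m div d"
    have de: "m = d * e" using d(1) by (simp add: e_def)
    have le: "d\<^sup>2 \<le> n" "e\<^sup>2 \<le> n + 1" using d n by (auto simp: e_def intro: dvd_imp_le)
    consider "h < d\<^sup>2" | "h < e\<^sup>2" | "d\<^sup>2 \<le> h" "e\<^sup>2 \<le> h" by linarith
    then show "n \<in> (\<Union>d\<in>U. E1 d) \<union> (\<Union>d\<in>U. E2 d) \<union> (\<Union>m\<in>V. E3 m)"
    proof cases
      case 1
      then have "d \<in> U" "n \<in> E1 d" using le n d by (auto simp: U_def E1_def)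
      then show ?thesis by blast
    next
      case 2
      then have "e \<in> U" "n \<in> E2 e" using le n d by (auto simp: U_def E2_def e_def)
      then show ?thesis by blast
    next
      case 3
      then have "d\<^sup>2 * e\<^sup>2 \<le> h * h" by (intro mult_mono) auto
      then have "m\<^sup>2 \<le> h\<^sup>2" by (simp only: de power_mult_distrib power2_eq_square[of h])
      then have "m \<in> V" "n \<in> E3 m" using m n by (auto simp: V_def E3_def)
      then show ?thesis by blast
    qed
  qed
  then have "card (bad_set h L) \<le> card ((\<Union>d\<in>U. E1 d) \<union> (\<Union>d\<in>U. E2 d) \<union> (\<Union>m\<in>V. E3 m))"
    using finU finV by (intro card_mono) (auto simp: E1_def E2_def E3_def)
  also have "\<dots> \<le> card ((\<Union>d\<in>U. E1 d) \<union> (\<Union>d\<in>U. E2 d)) + card (\<Union>m\<in>V. E3 m)"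
    by (rule card_Un_le)
  also have "\<dots> \<le> card (\<Union>d\<in>U. E1 d) + card (\<Union>d\<in>U. E2 d) + card (\<Union>m\<in>V. E3 m)"
    by (intro add_right_mono card_Un_le)
  also have "\<dots> \<le> (\<Sum>d\<in>U. card (E1 d)) + (\<Sum>d\<in>U. card (E2 d)) + (\<Sum>m\<in>V. card (E3 m))"
    by (intro add_mono card_UN_le finU finV)
  finally have "real (card (bad_set h L))
      \<le> real ((\<Sum>d\<in>U. card (E1 d)) + (\<Sum>d\<in>U. card (E2 d)) + (\<Sum>m\<in>V. card (E3 m)))"
    by (simp only: of_nat_le_iff)
  then have le: "real (card (bad_set h L))
      \<le> (\<Sum>d\<in>U. real (card (E1 d))) + (\<Sum>d\<in>U. real (card (E2 d))) + (\<Sum>m\<in>V. real (card (E3 m)))"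
    by (simp only: of_nat_add of_nat_sum)
  \<comment> \<open>From d^2 <= L + 1 <= 2 L the rounding error 1 is at most 2 L / d^2, whence the
    constant 3.\<close>
  have U_sum: "(\<Sum>d\<in>U. f d) \<le> 3 * real L * (W * T)"
    if f: "\<And>d. d \<in> U \<Longrightarrow> f d \<le> real L / (real d)\<^sup>2 + 1" for f
  proof -
    have "(\<Sum>d\<in>U. f d) \<le> (\<Sum>d\<in>U. 3 * real L * real d powr (-2 + \<delta>))"
    proof (rule sum_mono)
      fix d assume d: "d \<in> U"
      then have "d > 0" by (cases d) (auto simp: U_def)
      have "real (d\<^sup>2) \<le> real (2 * L)" using d L1 unfolding of_nat_le_iff by (auto simp: U_def)
      then have "1 \<le> 2 * real L / (real d)\<^sup>2" using \<open>d > 0\<close> by (simp add: le_divide_eq)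
      then have "f d \<le> 3 * real L / (real d)\<^sup>2" using f[OF d] by simp
      also have "\<dots> = 3 * real L * real d powr (-2)"
        using \<open>d > 0\<close> by (simp add: powr_minus_divide powr_numeral)
      also have "\<dots> \<le> 3 * real L * real d powr (-2 + \<delta>)"
        using \<open>d > 0\<close> delta by (intro mult_left_mono powr_mono) auto
      finally show "f d \<le> 3 * real L * real d powr (-2 + \<delta>)" .
    qed
    also have "\<dots> \<le> 3 * real L * (W * T)"
      unfolding sum_distrib_left[symmetric] T_def
      using assms finU by (intro mult_left_mono sum_powr_tail_le) (auto simp: U_def)
    finally show ?thesis .
  qed
  have 1: "(\<Sum>d\<in>U. real (card (E1 d))) \<le> 3 * real L * (W * T)"
  proof (rule U_sum)
    fix d assume "d \<in> U"
    then have "d > 0" by (cases d) (auto simp: U_def)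
    then show "real (card (E1 d)) \<le> real L / (real d)\<^sup>2 + 1"
      using card_square_dvd_split[of d 1 0 L] unfolding E1_def[symmetric] by simp
  qed
  have 2: "(\<Sum>d\<in>U. real (card (E2 d))) \<le> 3 * real L * (W * T)"
  proof (rule U_sum)
    fix d assume "d \<in> U"
    then have "d > 0" by (cases d) (auto simp: U_def)
    then show "real (card (E2 d)) \<le> real L / (real d)\<^sup>2 + 1"
      using card_square_dvd_split[of 1 d 0 L] unfolding E2_def[symmetric] by simp
  qed
  have "(\<Sum>m\<in>V. real (card (E3 m))) \<le> (\<Sum>m\<in>V. 2 * real L * (real (card {d. d dvd m}) / (real m)\<^sup>2))"
  proof (rule sum_mono)
    fix m assume m: "m \<in> V"
    let ?t = "real (card {d. d dvd m})"
    have "m > 0" using m by (cases m) (auto simp: V_def)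
    have "m\<^sup>2 \<le> h\<^sup>2" using m unfolding V_def by blast
    then have "real (m\<^sup>2) \<le> real L" using assms(2) unfolding of_nat_le_iff by (rule le_trans)
    then have "1 \<le> real L / (real m)\<^sup>2" using \<open>m > 0\<close> by (simp add: le_divide_eq)
    then have "?t * 1 \<le> ?t * (real L / (real m)\<^sup>2)" by (rule mult_left_mono) simp
    then have "?t \<le> ?t * (real L / (real m)\<^sup>2)" by (simp only: mult_1_right)
    moreover have "real (card (E3 m)) \<le> ?t * (real L / (real m)\<^sup>2) + ?t"
      using card_square_dvd_consecutive[of m 0 L] m unfolding E3_def[symmetric] by (simp add: V_def)
    ultimately have "real (card (E3 m)) \<le> 2 * (?t * (real L / (real m)\<^sup>2))"
      unfolding mult_2 by (meson add_left_mono order_trans)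
    then show "real (card (E3 m)) \<le> 2 * real L * (?t / (real m)\<^sup>2)"
      by (simp only: times_divide_eq_right mult_ac)
  qed
  also have "\<dots> \<le> 2 * real L * (K * W * T)"
    unfolding sum_distrib_left[symmetric] T_def
    using assms finV by (intro mult_left_mono sum_divisors_tail_le) (auto simp: V_def)
  finally have 3: "(\<Sum>m\<in>V. real (card (E3 m))) \<le> 2 * real L * (K * W * T)" .
  have "real (card (bad_set h L)) \<le> 3 * real L * (W * T) + 3 * real L * (W * T) + 2 * real L * (K * W * T)"
    using le 1 2 3 by linarith
  also have "\<dots> = (6 + 2 * K) * W * real L * T" by algebra
  finally show ?thesis by (simp only: T_def)
qed

text \<open>Writing 1 / x = x^\<delta> x^(-1 - \<delta>) with x^\<delta> <= h^\<delta> bounds the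
  harmonic sum by h^\<delta> W without a logarithm.\<close>

lemma card_representations_powr_le:
  assumes "h > 0"
  shows "real (card {(x, y, z). x \<in> {1..h} \<and> y \<in> {1..h} \<and> z \<in> {1..h} \<and> x\<^sup>2 + y\<^sup>2 + z + 1 = n})
    \<le> 2 * (1 + W) * real h powr (1 + \<delta>)"
proof -
  have "(\<Sum>x\<in>{1..h}. 1 + real h / real x) = real h + real h * (\<Sum>x\<in>{1..h}. 1 / real x)"
    by (simp add: sum.distrib sum_distrib_left)
  also have "(\<Sum>x\<in>{1..h}. 1 / real x) \<le> (\<Sum>x\<in>{1..h}. real h powr \<delta> * real x powr (-1 - \<delta>))"
  proof (rule sum_mono)
    fix x assume x: "x \<in> {1..h}"
    have "1 / real x = real x powr (\<delta> + (-1 - \<delta>))" using x by (simp add: powr_minus_divide)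
    also have "\<dots> = real x powr \<delta> * real x powr (-1 - \<delta>)" by (rule powr_add)
    also have "\<dots> \<le> real h powr \<delta> * real x powr (-1 - \<delta>)"
      using x delta by (intro mult_right_mono powr_mono2) auto
    finally show "1 / real x \<le> real h powr \<delta> * real x powr (-1 - \<delta>)" .
  qed
  also have "\<dots> \<le> real h powr \<delta> * W"
    unfolding sum_distrib_left[symmetric] by (intro mult_left_mono sum_powr_le_W) auto
  finally have "(\<Sum>x\<in>{1..h}. 1 + real h / real x) \<le> real h + real h * (real h powr \<delta> * W)"
    by (simp add: mult_left_mono)
  also have "real h * (real h powr \<delta> * W) = W * real h powr (1 + \<delta>)"
    using assms by (simp add: powr_add)
  also have "real h + W * real h powr (1 + \<delta>) \<le> (1 + W) * real h powr (1 + \<delta>)"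
  proof -
    have "real h powr 1 \<le> real h powr (1 + \<delta>)" using assms delta by (intro powr_mono) auto
    then show ?thesis by (simp add: distrib_right)
  qed
  finally have "(\<Sum>x\<in>{1..h}. 1 + real h / real x) \<le> (1 + W) * real h powr (1 + \<delta>)" .
  then show ?thesis using card_representations_le[of h n] by linarith
qed

end

section \<open>Assembling the asymptotic formula\<close>

lemma moebius_mu_square_consecutive:
  "(moebius_mu n)\<^sup>2 * (moebius_mu (n + 1))\<^sup>2 = of_bool (squarefree (n * (n + 1)))"
proof -
  have "coprime n (n + 1)" by simp
  then have "squarefree (n * (n + 1)) \<longleftrightarrow> squarefree n \<and> squarefree (n + 1)"
    using squarefree_mult_coprime squarefree_multD by blast
  then show ?thesis unfolding moebius_mu_square by simp
qed

lemma consecutive_squarefree_sum_eq: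
  "consecutive_squarefree_sum H
     = (\<Sum>x\<in>{1..nat \<lfloor>H\<rfloor>}. \<Sum>y\<in>{1..nat \<lfloor>H\<rfloor>}. \<Sum>z\<in>{1..nat \<lfloor>H\<rfloor>}.
         of_bool (squarefree ((x\<^sup>2 + y\<^sup>2 + z + 1) * (x\<^sup>2 + y\<^sup>2 + z + 1 + 1))))"
  unfolding consecutive_squarefree_sum_def moebius_mu_square_consecutive[symmetric]
  by (simp add: numeral_2_eq_2)

context divisor_bound
begin

text \<open>The first summand bounds the error of the truncated sums. In the second,
  \<open>20 * K\<close> comes from the error at a bad integer, \<open>(6 + 2 * K) * W * 4\<close>
  from the number of bad integers, and \<open>2 * (1 + W)\<close> from the triples representing
  each.\<close>

definition main_const :: real where
  "main_const = K * (1 + W) + 20 * K * ((6 + 2 * K) * W * 4 * (2 * (1 + W)))"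

text \<open>Passing to \<open>small_sum\<close> costs the number of bad integers times the triples
  for each times the error at each, of orders h^(3/2 + \<delta>), h^(1 + \<delta>) and h^(4
  \<delta>). What remains is h^2 interval sums with error of order h^(1/2 + \<delta>).\<close>

lemma cube_sum_approx:
  assumes "h > 0"
  defines "S \<equiv> \<Sum>x\<in>{1..h}. \<Sum>y\<in>{1..h}. \<Sum>z\<in>{1..h}.
      of_bool (squarefree ((x\<^sup>2 + y\<^sup>2 + z + 1) * (x\<^sup>2 + y\<^sup>2 + z + 1 + 1)))"
  shows "\<bar>S - (\<Prod>p. euler_factor p) * real h ^ 3\<bar> \<le> main_const * real h powr (5/2 + 6 * \<delta>)"
proof -
  let ?C = "\<Prod>p. euler_factor p"
  let ?n = "\<lambda>x y z :: nat. x\<^sup>2 + y\<^sup>2 + z + 1"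
  \<comment> \<open>Each of the four summands of x^2 + y^2 + z + 1 is at most h^2.\<close>
  define L where "L = 4 * h\<^sup>2"
  define G where "G = bad_set h L"
  \<comment> \<open>Here n (n + 1) <= 4 h^2 * 5 h^2 = 20 h^4, and 20^\<delta> <= 20.\<close>
  define E where "E = 20 * K * real h powr (4 * \<delta>)"
  define D where "D n = of_bool (squarefree (n * (n + 1))) - real_of_int (small_sum h n)" for n
  define S1 where "S1 = (\<Sum>x\<in>{1..h}. \<Sum>y\<in>{1..h}. \<Sum>z\<in>{1..h}. real_of_int (small_sum h (?n x y z)))"
  have h1: "real h \<ge> 1" using assms by simp
  have E0: "E \<ge> 0" using K_pos by (simp add: E_def)

  have "S - S1 = (\<Sum>x\<in>{1..h}. \<Sum>y\<in>{1..h}. \<Sum>z\<in>{1..h}. D (?n x y z))"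
    unfolding S_def S1_def D_def by (simp only: sum_subtractf)
  also have "\<dots> = (\<Sum>(x, y, z)\<in>{1..h} \<times> {1..h} \<times> {1..h}. D (?n x y z))"
    by (simp add: sum.cartesian_product split_def)
  finally have eqD: "S - S1 = (\<Sum>(x, y, z)\<in>{1..h} \<times> {1..h} \<times> {1..h}. D (?n x y z))" .
  have "\<bar>\<Sum>(x, y, z)\<in>{1..h} \<times> {1..h} \<times> {1..h}. D (?n x y z)\<bar>
      \<le> (\<Sum>t\<in>{1..h} \<times> {1..h} \<times> {1..h}. \<bar>case t of (x, y, z) \<Rightarrow> D (?n x y z)\<bar>)"
    by (rule sum_abs)
  also have "\<dots> \<le> (\<Sum>t\<in>{1..h} \<times> {1..h} \<times> {1..h}. if t \<in> {(x, y, z). ?n x y z \<in> G} then E else 0)"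
  proof (rule sum_mono)
    fix t assume "t \<in> {1..h} \<times> {1..h} \<times> {1..h}"
    then obtain x y z where t: "t = (x, y, z)" "x \<in> {1..h}" "y \<in> {1..h}" "z \<in> {1..h}" by auto
    define n where "n = ?n x y z"
    have hh: "h \<le> h\<^sup>2" "1 \<le> h\<^sup>2" using assms by (auto simp: power2_eq_square)
    have "x\<^sup>2 \<le> h\<^sup>2" "y\<^sup>2 \<le> h\<^sup>2" "z \<le> h" using t by (auto intro: power_mono)
    then have n: "n > 0" "n \<le> L" using hh unfolding n_def L_def by linarith+
    have "n * (n + 1) \<le> (4 * h\<^sup>2) * (5 * h\<^sup>2)"
      using n(2) hh(2) unfolding L_def by (intro mult_mono) auto
    then have "real (n * (n + 1)) \<le> real ((4 * h\<^sup>2) * (5 * h\<^sup>2))" by (simp only: of_nat_le_iff)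
    also have "\<dots> = 20 * real h ^ 4" by (simp add: power2_eq_square power4_eq_xxxx)
    finally have "real (n * (n + 1)) powr \<delta> \<le> (20 * real h ^ 4) powr \<delta>"
      using delta by (intro powr_mono2) auto
    also have "\<dots> = 20 powr \<delta> * (real h powr 4) powr \<delta>"
      using h1 by (simp add: powr_mult powr_numeral)
    also have "\<dots> = 20 powr \<delta> * real h powr (4 * \<delta>)" by (simp only: powr_powr)
    also have "\<dots> \<le> 20 * real h powr (4 * \<delta>)"
    proof (rule mult_right_mono)
      have "(20::real) powr \<delta> \<le> 20 powr 1" using delta by (intro powr_mono) auto
      then show "(20::real) powr \<delta> \<le> 20" by simp
    qed simp
    finally have "K * real (n * (n + 1)) powr \<delta> \<le> K * (20 * real h powr (4 * \<delta>))"
      using K_pos by (intro mult_left_mono) auto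
    then have "K * real (n * (n + 1)) powr \<delta> \<le> E" by (simp only: E_def mult_ac)
    then have "\<bar>D n\<bar> \<le> (if n \<in> G then E else 0)"
      using small_sum_approx[OF n, of h] unfolding D_def G_def[symmetric] by (auto split: if_splits)
    then show "\<bar>case t of (x, y, z) \<Rightarrow> D (?n x y z)\<bar> \<le> (if t \<in> {(x, y, z). ?n x y z \<in> G} then E else 0)"
      by (simp add: t(1) n_def)
  qed
  also have "\<dots> = real (card (({1..h} \<times> {1..h} \<times> {1..h}) \<inter> {(x, y, z). ?n x y z \<in> G})) * E"
    by (subst sum.If_cases) auto
  also have "\<dots> \<le> (real (card G) * (2 * (1 + W) * real h powr (1 + \<delta>))) * E"
  proof (rule mult_right_mono[OF _ E0])
    define R where "R n = {(x, y, z). x \<in> {1..h} \<and> y \<in> {1..h} \<and> z \<in> {1..h} \<and> ?n x y z = n}" for n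
    have finR: "finite (R n)" for n
      by (rule finite_subset[of _ "{1..h} \<times> {1..h} \<times> {1..h}"]) (auto simp: R_def)
    have finG: "finite G" by (simp add: G_def bad_set_def)
    have "({1..h} \<times> {1..h} \<times> {1..h}) \<inter> {(x, y, z). ?n x y z \<in> G} \<subseteq> (\<Union>n\<in>G. R n)"
      by (auto simp: R_def)
    then have "card (({1..h} \<times> {1..h} \<times> {1..h}) \<inter> {(x, y, z). ?n x y z \<in> G}) \<le> card (\<Union>n\<in>G. R n)"
      using finG finR by (intro card_mono) auto
    also have "\<dots> \<le> (\<Sum>n\<in>G. card (R n))" by (rule card_UN_le[OF finG])
    finally have "real (card (({1..h} \<times> {1..h} \<times> {1..h}) \<inter> {(x, y, z). ?n x y z \<in> G}))
        \<le> real (\<Sum>n\<in>G. card (R n))" by (simp only: of_nat_le_iff)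
    also have "\<dots> = (\<Sum>n\<in>G. real (card (R n)))" by simp
    also have "\<dots> \<le> (\<Sum>n\<in>G. 2 * (1 + W) * real h powr (1 + \<delta>))"
      unfolding R_def by (intro sum_mono card_representations_powr_le assms(1))
    also have "\<dots> = real (card G) * (2 * (1 + W) * real h powr (1 + \<delta>))" by simp
    finally show "real (card (({1..h} \<times> {1..h} \<times> {1..h}) \<inter> {(x, y, z). ?n x y z \<in> G}))
        \<le> real (card G) * (2 * (1 + W) * real h powr (1 + \<delta>))" .
  qed
  also have "\<dots> \<le> (((6 + 2 * K) * W * real L * real h powr (-1/2 + \<delta>)) * (2 * (1 + W) * real h powr (1 + \<delta>))) * E"
    using E0 W_nonneg assms(1) unfolding G_def
    by (intro mult_right_mono card_bad_set_le) (auto simp: L_def)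
  also have "\<dots> = 20 * K * ((6 + 2 * K) * W * 4 * (2 * (1 + W))) * real h powr (5/2 + 6 * \<delta>)"
  proof -
    \<comment> \<open>The exponents come from L, the density of bad integers, the representations
      and \<open>E\<close>, in this order.\<close>
    have e: "5/2 + 6 * \<delta> = 2 + ((-1/2 + \<delta>) + ((1 + \<delta>) + 4 * \<delta>))" by simp
    have "real L = 4 * real h powr 2" using h1 by (simp add: L_def powr_numeral)
    then show ?thesis unfolding e powr_add E_def by (simp only: mult_ac)
  qed
  finally have large: "\<bar>S - S1\<bar> \<le> 20 * K * ((6 + 2 * K) * W * 4 * (2 * (1 + W))) * real h powr (5/2 + 6 * \<delta>)"
    unfolding eqD .

  define B where "B = K * (1 + W) * real h powr (1/2 + \<delta>)"
  have inner: "\<bar>(\<Sum>z\<in>{1..h}. real_of_int (small_sum h (?n x y z))) - real h * ?C\<bar> \<le> B" for x y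
  proof -
    define A where "A = x\<^sup>2 + y\<^sup>2 + 1"
    have "(\<Sum>z\<in>{1..h}. real_of_int (small_sum h (?n x y z))) = (\<Sum>n\<in>{A<..A + h}. real_of_int (small_sum h n))"
      by (rule sum.reindex_bij_witness[of _ "\<lambda>n. n - A" "\<lambda>z. A + z"]) (auto simp: A_def add_ac)
    also have "\<dots> = of_int (\<Sum>n\<in>{A<..A + h}. small_sum h n)" by simp
    finally show ?thesis using sum_small_sum_approx[OF assms(1), of A] by (simp only: B_def)
  qed
  have "S1 - ?C * real h ^ 3
      = (\<Sum>x\<in>{1..h}. \<Sum>y\<in>{1..h}. (\<Sum>z\<in>{1..h}. real_of_int (small_sum h (?n x y z))) - real h * ?C)"
    unfolding S1_def sum_subtractf by (simp add: power3_eq_cube mult_ac)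
  also have "\<bar>\<dots>\<bar> \<le> (\<Sum>x\<in>{1..h}. \<Sum>y\<in>{1..h}. B)"
    by (rule order_trans[OF sum_abs], rule sum_mono, rule order_trans[OF sum_abs], rule sum_mono, rule inner)
  also have "\<dots> = K * (1 + W) * (real h powr 2 * real h powr (1/2 + \<delta>))"
    using h1 by (simp add: B_def powr_numeral power2_eq_square)
  also have "\<dots> = K * (1 + W) * real h powr (5/2 + \<delta>)" by (subst powr_add[symmetric]) simp
  also have "\<dots> \<le> K * (1 + W) * real h powr (5/2 + 6 * \<delta>)"
    using h1 delta K_pos W_nonneg by (intro mult_left_mono powr_mono) auto
  finally have "\<bar>S1 - ?C * real h ^ 3\<bar> \<le> K * (1 + W) * real h powr (5/2 + 6 * \<delta>)" .
  with large show ?thesis unfolding main_const_def distrib_right by linarith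
qed

text \<open>Replacing H by its floor changes the cube by at most 3 H^2, which the error term
  absorbs.\<close>

lemma consecutive_squarefree_sum_approx:
  assumes "H \<ge> 1"
  shows "\<bar>of_int (consecutive_squarefree_sum H) - (\<Prod>p. euler_factor p) * H ^ 3\<bar>
    \<le> (main_const + 3 * \<bar>\<Prod>p. euler_factor p\<bar>) * H powr (5/2 + 6 * \<delta>)"
proof -
  let ?C = "\<Prod>p. euler_factor p" and ?e = "5/2 + 6 * \<delta>"
  define h where "h = nat \<lfloor>H\<rfloor>"
  have h: "h > 0" "real h \<le> H" "H < real h + 1" using assms unfolding h_def by linarith+
  have main0: "main_const \<ge> 0" using K_pos W_nonneg by (simp add: main_const_def)
  have "real_of_int (consecutive_squarefree_sum H)
      = (\<Sum>x\<in>{1..h}. \<Sum>y\<in>{1..h}. \<Sum>z\<in>{1..h}.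
         of_bool (squarefree ((x\<^sup>2 + y\<^sup>2 + z + 1) * (x\<^sup>2 + y\<^sup>2 + z + 1 + 1))))"
    unfolding consecutive_squarefree_sum_eq h_def[symmetric] by simp
  then have 1: "\<bar>of_int (consecutive_squarefree_sum H) - ?C * real h ^ 3\<bar> \<le> main_const * real h powr ?e"
    using cube_sum_approx[OF h(1)] by simp
  have 2: "main_const * real h powr ?e \<le> main_const * H powr ?e"
    using main0 h delta by (intro mult_left_mono powr_mono2) auto
  have "H ^ 3 - real h ^ 3 = (H - real h) * (H\<^sup>2 + H * real h + (real h)\<^sup>2)"
    by (simp add: algebra_simps power2_eq_square power3_eq_cube)
  also have "\<dots> \<le> 1 * (H\<^sup>2 + H * H + H\<^sup>2)"
    using h assms by (intro mult_mono add_mono mult_left_mono power_mono) auto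
  also have "\<dots> = 3 * H powr 2" using assms by (simp add: powr_numeral power2_eq_square)
  also have "\<dots> \<le> 3 * H powr ?e" using assms delta by (intro mult_left_mono powr_mono) auto
  finally have "H ^ 3 - real h ^ 3 \<le> 3 * H powr ?e" .
  moreover have "real h ^ 3 \<le> H ^ 3" using h by (intro power_mono) auto
  ultimately have "\<bar>?C\<bar> * \<bar>real h ^ 3 - H ^ 3\<bar> \<le> \<bar>?C\<bar> * (3 * H powr ?e)"
    by (intro mult_left_mono) auto
  then have 3: "\<bar>?C * real h ^ 3 - ?C * H ^ 3\<bar> \<le> 3 * \<bar>?C\<bar> * H powr ?e"
    by (simp add: abs_mult flip: right_diff_distrib)
  show ?thesis using 1 2 3 unfolding distrib_right by linarith
qed

end

theorem theorem2:
  fixes \<epsilon> :: real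
  assumes "\<epsilon> > 0"
  shows "convergent_prod euler_factor \<and>
         (\<lambda>H::real. real_of_int (consecutive_squarefree_sum H) - (\<Prod>p. euler_factor p) * H ^ 3)
           \<in> O[at_top](\<lambda>H. H powr (5 / 2 + \<epsilon>))"
proof
  show "convergent_prod euler_factor" by (rule convergent_prod_euler_factor)
  \<comment> \<open>The accumulated loss is 6 \<delta>, so \<epsilon> / 6 suffices; 1/8 keeps
    \<delta> below 1/4 when \<epsilon> is large.\<close>
  define \<delta> where "\<delta> = min (\<epsilon> / 6) (1 / 8)"
  have \<delta>: "0 < \<delta>" "\<delta> < 1 / 4" "6 * \<delta> \<le> \<epsilon>" using assms by (auto simp: \<delta>_def)
  obtain K where K: "K > 0" "\<And>n::nat. n > 0 \<Longrightarrow> 2 ^ card (prime_factors n) \<le> K * real n powr \<delta>"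
    using two_power_omega_le[OF \<delta>(1)] by metis
  interpret divisor_bound \<delta> K by unfold_locales (use \<delta> K in auto)
  let ?B = "main_const + 3 * \<bar>\<Prod>p. euler_factor p\<bar>"
  have "?B \<ge> 0" using K_pos W_nonneg by (simp add: main_const_def)
  show "(\<lambda>H::real. real_of_int (consecutive_squarefree_sum H) - (\<Prod>p. euler_factor p) * H ^ 3)
           \<in> O[at_top](\<lambda>H. H powr (5 / 2 + \<epsilon>))"
  proof (rule bigoI[of _ ?B], rule eventually_at_top_linorderI[of 1])
    fix H :: real assume H: "H \<ge> 1"
    have "H powr (5/2 + 6 * \<delta>) \<le> H powr (5/2 + \<epsilon>)" using H \<delta> by (intro powr_mono) auto
    then have "?B * H powr (5/2 + 6 * \<delta>) \<le> ?B * H powr (5/2 + \<epsilon>)"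
      using \<open>?B \<ge> 0\<close> by (rule mult_left_mono)
    then show "norm (real_of_int (consecutive_squarefree_sum H) - (\<Prod>p. euler_factor p) * H ^ 3)
        \<le> ?B * norm (H powr (5/2 + \<epsilon>))"
      using consecutive_squarefree_sum_approx[OF H] by simp
  qed
qed

end
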